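(* All subsequential distributional limits of $U_t/V_t$, as $t\searrow0$ (respectively, as $t\to\infty$), are continuous for any cdf $F$ in the class $\mathcal{X}$, if and only if $V_t$ is in the centered Feller class at $0$ (respectively, at $\infty$).
   Context: $\mathcal{X}$ is the class of nondegenerate random variables $X$ (identified with their cdfs $F$) with $E|X|<\infty$. $\Lambda$ is a Lévy measure on $\mathbb{R}$ with support in $(0,\infty)$ such that $\int_0^1 y\,\Lambda(\mathrm{d}y)<\infty$; $\overline{\Lambda}(x)=\Lambda((x,\infty))$, $\overline{\Lambda}(0+)=\lim_{x\searrow0}\overline{\Lambda}(x)$. For a cdf $F$ with $\int|x|F(\mathrm{d}x)<\infty$, $(U_t,V_t)$, $t\ge0$, is the bivariate Lévy process with joint characteristic function $$E e^{\mathrm{i}(\theta_1U_t+\theta_2V_t)}=\exp\left(t\int_{(0,\infty)}\int_{-\infty}^{\infty}\left(e^{\mathrm{i}(\theta_1u+\theta_2v)}-1\right)F(\mathrm{d}u/v)\,\Lambda(\mathrm{d}v)\right),$$ where $\int\int g(u,v)F(\mathrm{d}u/v)\Lambda(\mathrm{d}v)=\int\int g(xv,v)F(\mathrm{d}x)\Lambda(\mathrm{d}v)$. In particular $V_t$ is a driftless subordinator with Lévy measure $\Lambda$ (its law does not depend on $F$). Convention: $0/0:=0$. In the case $t\searrow0$ it is assumed that $\overline{\Lambda}(0+)=\infty$. A Lévy process $Y_t$ is in the Feller class at infinity if there exist a norming function $B(t)$ and a centering function $A(t)$ such that for each sequence $t_k\to\infty$ there is a subsequence $t_k'\to\infty$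 with $(Y_{t_k'}-A(t_k'))/B(t_k')\overset{\mathrm{D}}{\to}W$ as $k\to\infty$, where $W$ is a nondegenerate random variable (possibly depending on the subsequence). It is in the centered Feller class at infinity if this holds with $A(t)\equiv0$ as a possible choice. The (centered) Feller class at zero is defined by replacing $t_k,t_k'\to\infty$ by $t_k,t_k'\searrow0$. A distribution is continuous if its cdf is continuous. A subsequential distributional limit as $t\searrow0$ ($t\to\infty$) is a limit in distribution of $U_{t_k}/V_{t_k}$ along some sequence $t_k\searrow0$ ($t_k\to\infty$). *)

theory Defs
  imports "HOL-Probability.Probability"
begin

text \<open>Distributions are represented by Borel probability measures on the reals
  (\<^locale>\<open>real_distribution\<close>), which correspond to cdfs via \<^const>\<open>cdf\<close>.\<close>

definition nondegenerate :: "real measure \<Rightarrow> bool" where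
  "nondegenerate \<mu> \<longleftrightarrow> \<not> (\<exists>c. measure \<mu> {c} = 1)"

definition continuous_distribution :: "real measure \<Rightarrow> bool" where
  "continuous_distribution \<mu> \<longleftrightarrow> continuous_on UNIV (cdf \<mu>)"

definition finite_mean_distribution :: "real measure \<Rightarrow> bool" where
  "finite_mean_distribution F \<longleftrightarrow> real_distribution F \<and> integrable F (\<lambda>x. x)"

definition class_X :: "real measure set" where
  "class_X = {F. finite_mean_distribution F \<and> nondegenerate F}"

definition levy_measure :: "real measure \<Rightarrow> bool" where
  "levy_measure \<Lambda> \<longleftrightarrow> sets \<Lambda> = sets borel \<and> emeasure \<Lambda> {0} = 0 \<and>
     (\<integral>\<^sup>+x. ennreal (min 1 (x\<^sup>2)) \<partial>\<Lambda>) < \<infinity>"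

text \<open>``Support in $(0,\infty)$'' means that the measure is concentrated on $(0,\infty)$;
  mass may accumulate at 0.\<close>

definition subordinator_levy_measure :: "real measure \<Rightarrow> bool" where
  "subordinator_levy_measure \<Lambda> \<longleftrightarrow> levy_measure \<Lambda> \<and> emeasure \<Lambda> {..0} = 0 \<and>
     (\<integral>\<^sup>+y\<in>{0..1}. ennreal y \<partial>\<Lambda>) < \<infinity>"

definition levy_tail :: "real measure \<Rightarrow> real \<Rightarrow> ennreal" where
  "levy_tail \<Lambda> x = emeasure \<Lambda> {x<..}"

text \<open>Processes have type \<^typ>\<open>real \<Rightarrow> 'a \<Rightarrow> 'b\<close>, but only times $t \ge 0$ are meaningful;
  values at negative times are unconstrained.\<close>

definition levy_process ::
    "'a measure \<Rightarrow> (real \<Rightarrow> 'a \<Rightarrow> 'b::euclidean_space) \<Rightarrow> bool" where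
  "levy_process M X \<longleftrightarrow>
     prob_space M \<and>
     (\<forall>t\<ge>0. X t \<in> borel_measurable M) \<and>
     (AE \<omega> in M. X 0 \<omega> = 0) \<and>
     (\<forall>(n::nat) s. 0 \<le> s 0 \<and> mono s \<longrightarrow>
        prob_space.indep_vars M (\<lambda>_. borel) (\<lambda>i \<omega>. X (s (Suc i)) \<omega> - X (s i) \<omega>) {..<n}) \<and>
     (\<forall>s\<ge>0. \<forall>t\<ge>0. distr M borel (\<lambda>\<omega>. X (s + t) \<omega> - X s \<omega>) = distr M borel (X t)) \<and>
     (\<forall>t\<ge>0. \<forall>\<epsilon>>0.
        ((\<lambda>s. measure M {\<omega> \<in> space M. norm (X s \<omega> - X t \<omega>) > \<epsilon>}) \<longlongrightarrow> 0)
          (at t within {0..})) \<and>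
     (AE \<omega> in M. \<forall>t\<ge>0. continuous (at_right t) (\<lambda>s. X s \<omega>) \<and>
        (t > 0 \<longrightarrow> (\<exists>l. ((\<lambda>s. X s \<omega>) \<longlongrightarrow> l) (at_left t))))"

text \<open>The integral of $g(u,v)$ against $F(\mathrm{d}u/v)\,\Lambda(\mathrm{d}v)$ is the integral of
  $g(xv,v)$ against $F(\mathrm{d}x)\,\Lambda(\mathrm{d}v)$.\<close>

definition randomly_weighted_pair ::
    "real measure \<Rightarrow> real measure \<Rightarrow> 'a measure \<Rightarrow> (real \<Rightarrow> 'a \<Rightarrow> real) \<Rightarrow> (real \<Rightarrow> 'a \<Rightarrow> real)
       \<Rightarrow> bool" where
  "randomly_weighted_pair \<Lambda> F M U V \<longleftrightarrow>
     levy_process M (\<lambda>t \<omega>. (U t \<omega>, V t \<omega>)) \<and>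
     (\<forall>t\<ge>0. \<forall>\<theta>\<^sub>1 \<theta>\<^sub>2 :: real.
        (LINT \<omega>|M. iexp (\<theta>\<^sub>1 * U t \<omega> + \<theta>\<^sub>2 * V t \<omega>)) =
        exp (complex_of_real t *
          (LINT v:{0<..}|\<Lambda>. (LINT x|F. iexp (\<theta>\<^sub>1 * (x * v) + \<theta>\<^sub>2 * v) - 1))))"

text \<open>Below, the filter \<open>G\<close> is \<^term>\<open>at_right (0::real)\<close> for limits at zero and
  \<^term>\<open>at_top :: real filter\<close> for limits at infinity.\<close>

definition time_sequence :: "real filter \<Rightarrow> (nat \<Rightarrow> real) \<Rightarrow> bool" where
  "time_sequence G t \<longleftrightarrow> (\<forall>k. t k > 0) \<and> filterlim t G sequentially"

definition norms_to_feller ::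
    "real filter \<Rightarrow> 'a measure \<Rightarrow> (real \<Rightarrow> 'a \<Rightarrow> real) \<Rightarrow> (real \<Rightarrow> real) \<Rightarrow> (real \<Rightarrow> real) \<Rightarrow> bool" where
  "norms_to_feller G M Y A B \<longleftrightarrow>
     (\<forall>t>0. B t > 0) \<and>
     (\<forall>t. time_sequence G t \<longrightarrow>
        (\<exists>r \<mu>. strict_mono (r :: nat \<Rightarrow> nat) \<and> real_distribution \<mu> \<and> nondegenerate \<mu> \<and>
           weak_conv_m
             (\<lambda>k. distr M borel (\<lambda>\<omega>. (Y (t (r k)) \<omega> - A (t (r k))) / B (t (r k)))) \<mu>))"

definition centered_feller_class ::
    "real filter \<Rightarrow> 'a measure \<Rightarrow> (real \<Rightarrow> 'a \<Rightarrow> real) \<Rightarrow> bool" where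
  "centered_feller_class G M Y \<longleftrightarrow> (\<exists>B. norms_to_feller G M Y (\<lambda>_. 0) B)"

text \<open>Division by zero yields zero in HOL, which agrees with the convention $0/0 := 0$
  (almost surely, the numerator vanishes whenever the denominator does).\<close>

definition subsequential_ratio_limit ::
    "real filter \<Rightarrow> 'a measure \<Rightarrow> (real \<Rightarrow> 'a \<Rightarrow> real) \<Rightarrow> (real \<Rightarrow> 'a \<Rightarrow> real) \<Rightarrow> real measure \<Rightarrow> bool"
  where
  "subsequential_ratio_limit G M U V \<mu> \<longleftrightarrow>
     real_distribution \<mu> \<and>
     (\<exists>t. time_sequence G t \<and>
        weak_conv_m (\<lambda>k. distr M borel (\<lambda>\<omega>. U (t k) \<omega> / V (t k) \<omega>)) \<mu>)"

end

theory Submission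
  imports Defs
begin

text \<open>
  Let \<open>\<nu>\<^sub>t\<close> be the law of \<open>V\<^sub>t\<close>. The argument uses only the one-dimensional laws of linear
  combinations of \<open>U\<^sub>t\<close> and \<open>V\<^sub>t\<close>, whose characteristic functions are
  \<open>\<theta> \<mapsto> exp (t E \<Psi>(\<theta> (a X + b)))\<close>, where \<open>\<Psi>\<close> is the exponent of \<open>V\<close> and \<open>X\<close> has law \<open>F\<close>
  (\<open>char_linear_combination\<close>). In particular the modulus of the characteristic function of \<open>\<nu>\<^sub>t\<close> is
  \<open>exp (- t h)\<close>, where \<open>h(\<theta>) = \<integral> (1 - cos (\<theta> v)) \<Lambda>(dv)\<close>.

  A centered Feller \<open>V\<close> has continuous ratio limits. Along a subsequence, \<open>V\<^sub>t / B(t)\<close> converges to a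
  nondegenerate \<open>W\<close>. The exponent \<open>\<rho> = - ln |char W|\<close> is unbounded: if it were bounded by \<open>C\<close>, then
  dividing the times by \<open>m\<close> would give limits with exponents bounded by \<open>C/m\<close>, and a diagonal sequence
  would have a degenerate limit (\<open>char_of_limit_not_bounded_below\<close>). As a limit of rescaled copies of
  \<open>h\<close>, \<open>\<rho>\<close> is subadditive up to a factor, and for such an unbounded function the sublevel sets have
  density zero, because they have arbitrarily many disjoint translates (\<open>sublevel_sets_sparse\<close>).
  Therefore \<open>|char W|\<close> is small at most points of a large interval, and so, by Jensen's inequality, is
  the modulus of the characteristic function of \<open>(U\<^sub>t - c V\<^sub>t) / B(t)\<close>, since \<open>X \<noteq> c\<close> has positive
  probability. Hence neither this variable nor \<open>V\<^sub>t / B(t)\<close> accumulates mass near 0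
  (\<open>concentration_near_0\<close>). Together with the tightness of \<open>V\<^sub>t / B(t)\<close>, this excludes an atom of the
  limit of \<open>U\<^sub>t / V\<^sub>t\<close> at \<open>c\<close>.

  Conversely, let \<open>X\<close> be a fair coin. Then \<open>R = U\<^sub>2\<^sub>t\<close> and \<open>S = V\<^sub>2\<^sub>t - U\<^sub>2\<^sub>t\<close> behave like
  independent nonnegative variables with law \<open>\<nu>\<^sub>t\<close>, and the ratio is \<open>R / (R + S)\<close>. Norm \<open>\<nu>\<^sub>t\<close> by
  its median. If the normed laws were not tight, then \<open>S\<close> would be much larger than \<open>R\<close> with
  probability bounded away from 0, and the ratio would have a limit with an atom at 0; if they had a
  degenerate limit, then \<open>R / S\<close> would tend to 1 and the ratio to the constant 1/2. So if all ratio
  limits are continuous, then the median is a centered norming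
  (\<open>compact_norming_if_ratio_limits_continuous\<close>).
\<close>

section \<open>Weak convergence and characteristic functions\<close>

lemma weak_conv_m_subseq:
  assumes "weak_conv_m \<mu> M" "strict_mono r"
  shows "weak_conv_m (\<lambda>k. \<mu> (r k)) M"
  using assms LIMSEQ_subseq_LIMSEQ unfolding weak_conv_m_def weak_conv_def comp_def by blast

text \<open>Pointwise convergence of characteristic functions is locally uniform; Skorohod coupling turns this
  into dominated convergence along an almost surely convergent sequence.\<close>
lemma char_tendsto_moving_argument:
  assumes \<mu>: "\<And>n. real_distribution (\<mu> n)" and M: "real_distribution M"
    and conv: "weak_conv_m \<mu> M" and s: "s \<longlonglongrightarrow> \<sigma>"
  shows "(\<lambda>n. char (\<mu> n) (s n)) \<longlonglongrightarrow> char M \<sigma>"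
proof -
  obtain \<Omega> :: "real measure" and Y_seq Y where \<Omega>: "prob_space \<Omega>"
    and [measurable]: "\<And>n. Y_seq n \<in> borel_measurable \<Omega>"
    and dn: "\<And>n. distr \<Omega> borel (Y_seq n) = \<mu> n"
    and Y: "Y \<in> measurable \<Omega> lborel" and d: "distr \<Omega> borel Y = M"
    and lim: "\<And>x. x \<in> space \<Omega> \<Longrightarrow> (\<lambda>n. Y_seq n x) \<longlonglongrightarrow> Y x"
    using Skorohod[OF \<mu> M conv] by metis
  interpret prob_space \<Omega> by (rule \<Omega>)
  have [measurable]: "Y \<in> borel_measurable \<Omega>" using Y by simp
  have "char (\<mu> n) (s n) = (CLINT x|\<Omega>. iexp (s n * Y_seq n x))" for n
    unfolding char_def dn[symmetric] by (subst integral_distr) auto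
  moreover have "char M \<sigma> = (CLINT x|\<Omega>. iexp (\<sigma> * Y x))"
    unfolding char_def d[symmetric] by (subst integral_distr) auto
  moreover have "(\<lambda>n. CLINT x|\<Omega>. iexp (s n * Y_seq n x)) \<longlonglongrightarrow> (CLINT x|\<Omega>. iexp (\<sigma> * Y x))"
    by (rule integral_dominated_convergence[where w="\<lambda>_. 1"])
       (auto intro!: AE_I2 tendsto_intros s lim)
  ultimately show ?thesis by simp
qed

lemma integral_nonneg_eq_0_AE:
  fixes f :: "'a \<Rightarrow> real"
  assumes "integrable M f" "\<And>x. 0 \<le> f x" "integral\<^sup>L M f = 0"
  shows "AE x in M. f x = 0"
  using assms integral_nonneg_eq_0_iff_AE[of M f] by auto

text \<open>If the modulus is 1 at \<open>s\<close>, the distribution lives on a translate of the lattice with mesh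
  \<open>2 \<pi> / s\<close>. Letting \<open>s\<close> run through the powers of 1/2, these meshes grow without bound, which
  leaves room for a single point.\<close>
lemma degenerate_if_norm_char_eq_1:
  assumes M: "real_distribution M" and one: "\<And>j::nat. cmod (char M (1 / 2 ^ j)) = 1"
  shows "\<not> nondegenerate M"
proof -
  interpret real_distribution M by (rule M)
  define a where "a j = Arg (char M (1 / 2 ^ j))" for j :: nat
  have "AE x in M. cos (x / 2 ^ j - a j) = 1" for j
  proof -
    have int: "integrable M (\<lambda>x. iexp (x / 2 ^ j - a j))"
      by (intro integrable_iexp) auto
    have ch: "char M (1 / 2 ^ j) = iexp (a j)"
      using rcis_cmod_Arg[of "char M (1 / 2 ^ j)"] one[of j] by (simp add: a_def rcis_def cis_conv_exp)
    have "(CLINT x|M. iexp (x / 2 ^ j - a j)) = (CLINT x|M. iexp (- a j) * iexp (1 / 2 ^ j * x))"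
      by (intro Bochner_Integration.integral_cong) (auto simp flip: exp_add simp: algebra_simps)
    also have "\<dots> = iexp (- a j) * char M (1 / 2 ^ j)"
      unfolding char_def by simp
    also have "\<dots> = 1" unfolding ch by (simp flip: exp_add)
    finally have "Re (CLINT x|M. iexp (x / 2 ^ j - a j)) = 1" by simp
    moreover have "Re (CLINT x|M. iexp (x / 2 ^ j - a j)) = (LINT x|M. Re (iexp (x / 2 ^ j - a j)))"
      using int by simp
    ultimately have 1: "(LINT x|M. cos (x / 2 ^ j - a j)) = 1"
      by (simp add: Re_exp)
    have ic: "integrable M (\<lambda>x. cos (x / 2 ^ j - a j))"
      by (intro integrable_const_bound[of _ 1]) auto
    have "AE x in M. 1 - cos (x / 2 ^ j - a j) = 0"
      using ic 1 prob_space by (intro integral_nonneg_eq_0_AE) auto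
    then show ?thesis by auto
  qed
  then have "AE x in M. \<forall>j. cos (x / 2 ^ j - a j) = 1"
    by (subst AE_all_countable) auto
  moreover have unique: "x = y" if xy: "\<forall>j. cos (x / 2 ^ j - a j) = 1" "\<forall>j. cos (y / 2 ^ j - a j) = 1" for x y
  proof (rule ccontr)
    assume "x \<noteq> y"
    \<comment> \<open>both points lie on a translate of each of the lattices \<open>2\<pi>2\<^sup>j\<int>\<close>, whose mesh is unbounded\<close>
    obtain j :: nat where j: "\<bar>x - y\<bar> / 2 ^ j < 1"
      using real_arch_pow[of 2 "\<bar>x - y\<bar>"] by (auto simp: field_simps)
    obtain m n :: int where "x / 2 ^ j - a j = of_int m * 2 * pi" "y / 2 ^ j - a j = of_int n * 2 * pi"
      using xy[THEN spec, of j] unfolding cos_one_2pi_int by blast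
    then have *: "(x - y) / 2 ^ j = of_int (m - n) * (2 * pi)"
      by (simp add: algebra_simps diff_divide_distrib)
    then have "m \<noteq> n" using \<open>x \<noteq> y\<close> by auto
    then have "1 \<le> \<bar>of_int (m - n) :: real\<bar>" by linarith
    then have "1 * (2 * pi) \<le> \<bar>of_int (m - n) :: real\<bar> * (2 * pi)"
      by (intro mult_right_mono) auto
    also have "\<dots> = \<bar>(x - y) / 2 ^ j\<bar>" unfolding * by (simp add: abs_mult)
    also have "\<dots> < 1" using j by simp
    finally show False using pi_gt3 by simp
  qed
  ultimately have ae: "AE x in M. \<forall>j. cos (x / 2 ^ j - a j) = 1" by simp
  then obtain c where c: "\<forall>j. cos (c / 2 ^ j - a j) = 1"
    using eventually_happens ae_filter_bot by blast
  have "AE x in M. x \<in> {c}"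
    using ae by eventually_elim (use unique c in auto)
  then have "prob {c} = 1" by (subst (asm) AE_in_set_eq_1) auto
  then show ?thesis unfolding nondegenerate_def by auto
qed

lemma real_distribution_pair_linear:
  assumes "real_distribution D1" "real_distribution D2"
  shows "real_distribution (distr (D1 \<Otimes>\<^sub>M D2) borel (\<lambda>z. a * fst z + b * snd z))"
proof -
  interpret D1: real_distribution D1 by fact
  interpret D2: real_distribution D2 by fact
  interpret pair_prob_space D1 D2 ..
  show ?thesis by (intro real_distribution_distr) measurable
qed

lemma char_pair_linear:
  assumes "real_distribution D1" "real_distribution D2"
  shows "char (distr (D1 \<Otimes>\<^sub>M D2) borel (\<lambda>z. a * fst z + b * snd z)) \<theta>
    = char D1 (a * \<theta>) * char D2 (b * \<theta>)"
proof -
  interpret D1: real_distribution D1 by fact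
  interpret D2: real_distribution D2 by fact
  interpret P: pair_prob_space D1 D2 ..
  have m: "(\<lambda>z. a * fst z + b * snd z) \<in> borel_measurable (D1 \<Otimes>\<^sub>M D2)" by measurable
  have "char (distr (D1 \<Otimes>\<^sub>M D2) borel (\<lambda>z. a * fst z + b * snd z)) \<theta>
      = (CLINT z|D1 \<Otimes>\<^sub>M D2. iexp (\<theta> * (a * fst z + b * snd z)))"
    unfolding char_def by (subst integral_distr[OF m]) auto
  also have "\<dots> = (CLINT z|D1 \<Otimes>\<^sub>M D2. iexp (a * \<theta> * fst z) * iexp (b * \<theta> * snd z))"
    by (intro Bochner_Integration.integral_cong) (auto simp flip: exp_add simp: algebra_simps)
  also have "\<dots> = (CLINT x|D1. (CLINT y|D2. iexp (a * \<theta> * x) * iexp (b * \<theta> * y)))"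
    by (subst P.integral_fst'[symmetric])
       (auto intro!: P.integrable_const_bound[of _ 1] simp: norm_mult)
  also have "\<dots> = char D1 (a * \<theta>) * char D2 (b * \<theta>)"
    unfolding char_def by simp
  finally show ?thesis .
qed

text \<open>For a standard normal \<open>N\<close> independent of \<open>Y\<close>, computing the mean of \<open>exp (i T N Y)\<close> in both
  orders gives \<open>E exp (- T\<^sup>2 Y\<^sup>2 / 2) = E (char Y)(T N)\<close>, and the left side controls the mass of \<open>Y\<close>
  near 0. The constant 2 bounds \<open>exp (1/2)\<close>.\<close>
lemma measure_near_0_le_gaussian_mean_of_char:
  assumes D: "real_distribution D" and T: "T > 0"
  shows "measure D {x. \<bar>x\<bar> \<le> 1 / T} \<le> 2 * (LINT n|std_normal_distribution. cmod (char D (T * n)))"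
proof -
  interpret D: real_distribution D by fact
  interpret N: real_distribution std_normal_distribution by (rule real_dist_normal_dist)
  interpret P: pair_prob_space std_normal_distribution D ..
  have [measurable]: "char D \<in> borel_measurable borel" by (rule D.char_measurable)
  have bd: "1 \<le> 2 * exp (- (T * x)\<^sup>2 / 2)" if "\<bar>x\<bar> \<le> 1 / T" for x
  proof -
    have "\<bar>T * x\<bar> \<le> 1" using that T by (simp add: abs_mult field_simps)
    then have "(T * x)\<^sup>2 \<le> 1" by (simp add: abs_square_le_1)
    have "1 / 2 = 1 + (-1/2 :: real)" by simp
    also have "\<dots> \<le> exp (-1/2)" by (rule exp_ge_add_one_self)
    also have "\<dots> \<le> exp (- (T * x)\<^sup>2 / 2)" using \<open>(T * x)\<^sup>2 \<le> 1\<close> by simp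
    finally show ?thesis by simp
  qed
  have "measure D {x. \<bar>x\<bar> \<le> 1 / T} = (LINT x|D. indicator {x. \<bar>x\<bar> \<le> 1 / T} x)"
    by simp
  also have "\<dots> \<le> (LINT x|D. 2 * exp (- (T * x)\<^sup>2 / 2))"
    by (intro integral_mono D.integrable_const_bound[of _ 2] D.integrable_const_bound[of _ 1])
       (use bd in \<open>auto split: split_indicator\<close>)
  also have "\<dots> = 2 * (LINT x|D. exp (- (T * x)\<^sup>2 / 2))" by simp
  also have "(LINT x|D. exp (- (T * x)\<^sup>2 / 2)) = Re (CLINT x|D. char std_normal_distribution (T * x))"
    unfolding char_std_normal_distribution integral_complex_of_real by simp
  also have "(CLINT x|D. char std_normal_distribution (T * x))
      = (CLINT x|D. (CLINT n|std_normal_distribution. iexp (T * x * n)))"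
    unfolding char_def by simp
  also have "\<dots> = (CLINT n|std_normal_distribution. (CLINT x|D. iexp (T * x * n)))"
    by (rule P.Fubini_integral) (auto intro!: P.integrable_const_bound[of _ 1] simp: split_beta')
  also have "\<dots> = (CLINT n|std_normal_distribution. char D (T * n))"
    unfolding char_def by (simp add: mult_ac)
  also have "Re \<dots> \<le> cmod \<dots>" by (rule complex_Re_le_cmod)
  also have "\<dots> \<le> (LINT n|std_normal_distribution. cmod (char D (T * n)))"
    by (rule integral_norm_bound)
  finally show ?thesis by simp
qed

lemma weak_conv_m_imp_eventually_tight:
  assumes \<mu>: "\<And>n. real_distribution (\<mu> n)" and M: "real_distribution M"
    and conv: "weak_conv_m \<mu> M" and \<epsilon>: "\<epsilon> > 0"
  obtains K where "K > 0" "eventually (\<lambda>k. measure (\<mu> k) {x. \<bar>x\<bar> > K} < \<epsilon>) sequentially"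
proof -
  interpret M: real_distribution M by fact
  have "(\<lambda>K. LINT x|M. min 1 (\<bar>x\<bar> / real (Suc K))) \<longlonglongrightarrow> (LINT x|M. 0)"
  proof (rule integral_dominated_convergence[where w="\<lambda>_. 1"])
    show "AE x in M. (\<lambda>K. min 1 (\<bar>x\<bar> / real (Suc K))) \<longlonglongrightarrow> 0"
    proof (rule AE_I2)
      fix x
      have "(\<lambda>K. min 1 (\<bar>x\<bar> / real (Suc K))) \<longlonglongrightarrow> min 1 0"
        by (intro tendsto_min tendsto_const LIMSEQ_Suc lim_const_over_n)
      then show "(\<lambda>K. min 1 (\<bar>x\<bar> / real (Suc K))) \<longlonglongrightarrow> 0" by simp
    qed
  qed auto
  then have "eventually (\<lambda>K. (LINT x|M. min 1 (\<bar>x\<bar> / real (Suc K))) < \<epsilon>) sequentially"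
    using order_tendstoD(2)[of _ "LINT x|M. 0" sequentially \<epsilon>] \<epsilon> by simp
  then obtain K where K: "(LINT x|M. min 1 (\<bar>x\<bar> / real (Suc K))) < \<epsilon>"
    by (auto simp: eventually_sequentially)
  have "(\<lambda>k. LINT x|\<mu> k. min 1 (\<bar>x\<bar> / real (Suc K))) \<longlonglongrightarrow> (LINT x|M. min 1 (\<bar>x\<bar> / real (Suc K)))"
    by (rule weak_conv_imp_integral_bdd_continuous_conv[OF \<mu> M conv, where B=1])
       (auto intro!: continuous_intros)
  then have ev: "eventually (\<lambda>k. (LINT x|\<mu> k. min 1 (\<bar>x\<bar> / real (Suc K))) < \<epsilon>) sequentially"
    using K by (rule order_tendstoD(2))
  have "eventually (\<lambda>k. measure (\<mu> k) {x. \<bar>x\<bar> > real (Suc K)} < \<epsilon>) sequentially"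
    using ev
  proof eventually_elim
    case (elim k)
    interpret D: real_distribution "\<mu> k" by (rule \<mu>)
    have "measure (\<mu> k) {x. \<bar>x\<bar> > real (Suc K)} = (LINT x|\<mu> k. indicator {x. \<bar>x\<bar> > real (Suc K)} x)"
      by simp
    also have "\<dots> \<le> (LINT x|\<mu> k. min 1 (\<bar>x\<bar> / real (Suc K)))"
      by (intro integral_mono D.integrable_const_bound[of _ 1])
         (auto split: split_indicator simp: min_def field_simps)
    finally show ?case using elim by simp
  qed
  then show thesis by (intro that[of "real (Suc K)"]) auto
qed

section \<open>Unbounded quasi-subadditive functions are large at most points\<close>

text \<open>This abstracts the functions \<open>\<theta> \<mapsto> \<integral> (1 - cos (\<theta> v)) \<Lambda>(dv)\<close>. For these the
  square root is subadditive; the inequality with the factors 2 is a consequence that is linear in \<open>g\<close>,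
  so that it can be integrated over \<open>v\<close>.\<close>
definition even_quasi_subadditive :: "(real \<Rightarrow> real) \<Rightarrow> bool" where
  "even_quasi_subadditive g \<longleftrightarrow>
    (\<forall>x. 0 \<le> g x \<and> g (- x) = g x) \<and> (\<forall>x y. g (x + y) \<le> 2 * g x + 2 * g y)"

lemma even_quasi_subadditiveD:
  assumes "even_quasi_subadditive g"
  shows "0 \<le> g x" "g (- x) = g x" "g (x + y) \<le> 2 * g x + 2 * g y"
  using assms unfolding even_quasi_subadditive_def by blast+

text \<open>If \<open>r\<close> grows fast enough along the points \<open>u\<^sub>0, u\<^sub>1, \<dots>\<close>, the translates by \<open>u\<^sub>i\<close> of the sublevel set
  at height \<open>C\<close> are pairwise disjoint. After scaling by \<open>1/T\<close> the shifts are short, so \<open>n\<close> disjoint copies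
  of the rescaled set fit into a fixed interval.\<close>
lemma sublevel_sets_sparse:
  fixes r :: "real \<Rightarrow> real"
  assumes r_meas[measurable]: "r \<in> borel_measurable borel"
    and r: "even_quasi_subadditive r"
    and unb: "\<And>C. \<exists>u. C < r u" and L: "L > 0" and C: "C \<ge> 0"
  shows "((\<lambda>T. measure lborel {x. \<bar>x\<bar> \<le> L \<and> r (T * x) \<le> C}) \<longlongrightarrow> 0) at_top"
proof (rule order_tendstoI)
  fix \<epsilon> :: real assume \<epsilon>: "0 < \<epsilon>"
  obtain n :: nat where n: "(2 * L + 2) / \<epsilon> < real n" using reals_Archimedean2 by blast
  have npos: "0 < real n" using n L \<epsilon> divide_pos_pos[of "2 * L + 2" \<epsilon>] by linarith
  have "\<exists>u. \<forall>i::nat. 2 * r (u i) + 8 * C < r (u (Suc i))"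
    using dependent_nat_choice[of "\<lambda>_ _. True" "\<lambda>_ x y. 2 * r x + 8 * C < r y"] unb by auto
  then obtain u :: "nat \<Rightarrow> real" where u: "\<And>i. 2 * r (u i) + 8 * C < r (u (Suc i))" by auto
  note nn = even_quasi_subadditiveD(1)[OF r] and sub = even_quasi_subadditiveD(3)[OF r]
  \<comment> \<open>\<open>u j - u i\<close> is never a difference of two points at which \<open>r\<close> is at most \<open>C\<close>, since \<open>r\<close> is at most
    \<open>4 C\<close> at such a difference\<close>
  have gap: "2 * r (u i) + 8 * C < r (u j)" if "i < j" for i j
    using that
  proof (induction j)
    case (Suc j)
    then show ?case using u[of j] C nn[of "u j"] by (cases "i = j") auto
  qed simp
  define T0 where "T0 = Max ((\<lambda>i. \<bar>u i\<bar>) ` {..<n}) + 1"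
  have T0: "\<bar>u i\<bar> < T0" if "i < n" for i
  proof -
    have "\<bar>u i\<bar> \<le> Max ((\<lambda>i. \<bar>u i\<bar>) ` {..<n})" using that by (intro Max_ge) auto
    then show ?thesis unfolding T0_def by simp
  qed
  have "measure lborel {x. \<bar>x\<bar> \<le> L \<and> r (T * x) \<le> C} < \<epsilon>" if T: "T \<ge> max T0 1" for T
  proof -
    define E where "E = {x. \<bar>x\<bar> \<le> L \<and> r (T * x) \<le> C}"
    define E' where "E' i = (+) (- (u i / T)) -` E" for i
    have [measurable]: "E \<in> sets borel" unfolding E_def by measurable
    have E'_sets [measurable]: "E' i \<in> sets borel" for i
      unfolding E'_def using measurable_sets[of "(+) (- (u i / T))" borel borel E] by simp
    have Tpos: "T > 0" using T by simp
    have em: "emeasure lborel (E' i) = emeasure lborel E" for i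
    proof -
      have "emeasure lborel E = emeasure (distr lborel borel ((+) (- (u i / T)))) E"
        by (simp add: lborel_distr_plus)
      also have "\<dots> = emeasure lborel (E' i)"
        by (subst emeasure_distr) (auto simp: E'_def)
      finally show ?thesis by simp
    qed
    have E'_sub: "E' i \<subseteq> {- (L + 1) .. L + 1}" if "i < n" for i
    proof
      fix y assume y: "y \<in> E' i"
      have "\<bar>u i / T\<bar> \<le> 1" using T0[OF that] T Tpos by (simp add: field_simps)
      moreover have "\<bar>y - u i / T\<bar> \<le> L" using y unfolding E'_def E_def by simp
      ultimately show "y \<in> {- (L + 1) .. L + 1}" by (simp only: atLeastAtMost_iff) linarith
    qed
    have "disjoint_family_on E' {..<n}"
      unfolding disjoint_family_on_def
    proof safe
      fix i j x assume "i \<noteq> j" and x: "x \<in> E' i" "x \<in> E' j"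
      have *: False if ij: "i < j" and x: "x \<in> E' i" "x \<in> E' j" for i j
      proof -
        have 1: "r (T * x - u i) \<le> C" "r (T * x - u j) \<le> C"
          using x Tpos unfolding E'_def E_def by (auto simp: algebra_simps)
        have "r (u j) \<le> 2 * r (u i) + 2 * r (u j - u i)" using sub[of "u i" "u j - u i"] by simp
        also have "r (u j - u i) \<le> 2 * r (T * x - u i) + 2 * r (- (T * x - u j))"
          using sub[of "T * x - u i" "- (T * x - u j)"] by simp
        also have "\<dots> \<le> 4 * C" using 1 by (subst even_quasi_subadditiveD(2)[OF r]) simp
        finally show False using gap[OF ij] by simp
      qed
      show "x \<in> {}" using *[of i j] *[of j i] \<open>i \<noteq> j\<close> x by (meson linorder_neqE_nat)
    qed
    moreover have fin: "emeasure lborel (E' i) \<noteq> \<infinity>" if "i < n" for i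
      using emeasure_mono[OF E'_sub[OF that], of lborel] L by (auto simp: top_unique)
    ultimately have "measure lborel (\<Union>i<n. E' i) = (\<Sum>i<n. measure lborel (E' i))"
      by (intro measure_finite_Union) auto
    also have "\<dots> = real n * measure lborel E" using em by (simp add: measure_def)
    finally have "real n * measure lborel E = measure lborel (\<Union>i<n. E' i)" by simp
    also have "\<dots> \<le> measure lborel {- (L + 1) .. L + 1}"
      using E'_sub L by (intro measure_mono_fmeasurable) (auto simp: fmeasurable_def)
    also have "\<dots> = 2 * L + 2" using L by simp
    also have "\<dots> < real n * \<epsilon>" using n \<epsilon> by (simp add: field_simps)
    finally show ?thesis using npos unfolding E_def by simp
  qed
  then show "eventually (\<lambda>T. measure lborel {x. \<bar>x\<bar> \<le> L \<and> r (T * x) \<le> C} < \<epsilon>) at_top"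
    unfolding eventually_at_top_linorder by blast
qed (auto intro!: always_eventually less_le_trans[OF _ measure_nonneg])

lemma std_normal_measure_le_lborel:
  assumes [measurable]: "A \<in> sets borel" and "emeasure lborel A < \<infinity>"
  shows "measure std_normal_distribution A \<le> measure lborel A"
proof -
  have "std_normal_density x \<le> 1" for x
  proof -
    have "exp (- x\<^sup>2 / 2) * 1 \<le> 1 * sqrt (2 * pi)"
      using pi_gt3 by (intro mult_mono) auto
    then show ?thesis by (simp add: normal_density_def field_simps)
  qed
  then have "emeasure std_normal_distribution A \<le> (\<integral>\<^sup>+x. indicator A x \<partial>lborel)"
    by (subst emeasure_density) (auto intro!: nn_integral_mono split: split_indicator simp del: nn_integral_indicator)
  then show ?thesis using assms(2)
    unfolding measure_def by (intro enn2real_mono) auto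
qed

lemma gaussian_mean_exp_tendsto_0:
  fixes r :: "real \<Rightarrow> real"
  assumes r_meas[measurable]: "r \<in> borel_measurable borel"
    and r: "even_quasi_subadditive r"
    and unb: "\<And>C. \<exists>u. C < r u" and p: "p > 0"
  shows "((\<lambda>T. LINT n|std_normal_distribution. exp (- (p * r (T * n)))) \<longlongrightarrow> 0) at_top"
proof (rule order_tendstoI)
  interpret N: real_distribution std_normal_distribution by (rule real_dist_normal_dist)
  fix \<epsilon> :: real assume \<epsilon>: "0 < \<epsilon>"
  obtain C where C: "C \<ge> 0" "exp (- (p * C)) < \<epsilon> / 3"
  proof -
    have "((\<lambda>C. exp (- (p * C))) \<longlongrightarrow> 0) at_top"
      using p by real_asymp
    then have "eventually (\<lambda>C. exp (- (p * C)) < \<epsilon> / 3 \<and> C \<ge> 0) at_top"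
      using \<epsilon> by (intro eventually_conj eventually_ge_at_top) (rule order_tendstoD(2), auto)
    then show thesis using that eventually_happens[of _ "at_top :: real filter"] by auto
  qed
  obtain L where L: "L > 0" "measure std_normal_distribution {x. \<bar>x\<bar> > L} < \<epsilon> / 3"
    using weak_conv_m_imp_eventually_tight[of "\<lambda>_. std_normal_distribution" std_normal_distribution "\<epsilon> / 3"]
      real_dist_normal_dist \<epsilon>
    by (auto simp: weak_conv_m_def weak_conv_def)
  have "eventually (\<lambda>T. measure lborel {x. \<bar>x\<bar> \<le> L \<and> r (T * x) \<le> C} < \<epsilon> / 3) at_top"
    using \<epsilon> by (intro order_tendstoD(2)[OF sublevel_sets_sparse[OF r_meas r unb L(1) C(1)]]) auto
  then show "eventually (\<lambda>T. (LINT n|std_normal_distribution. exp (- (p * r (T * n)))) < \<epsilon>) at_top"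
  proof eventually_elim
    case (elim T)
    let ?A = "{x. \<bar>x\<bar> > L}" and ?B = "{x. \<bar>x\<bar> \<le> L \<and> r (T * x) \<le> C}"
    have [measurable]: "?A \<in> sets borel" "?B \<in> sets borel" by measurable
    have "(LINT n|std_normal_distribution. exp (- (p * r (T * n))))
        \<le> (LINT n|std_normal_distribution. exp (- (p * C)) + indicator ?A n + indicator ?B n)"
    proof (intro integral_mono)
      fix n
      show "exp (- (p * r (T * n))) \<le> exp (- (p * C)) + indicator ?A n + indicator ?B n"
      proof (cases "n \<in> ?A \<or> n \<in> ?B")
        case True
        have "exp (- (p * r (T * n))) \<le> 1" using p even_quasi_subadditiveD(1)[OF r] by simp
        then have "exp (- (p * r (T * n))) \<le> exp (- (p * C)) + 1"
          by (rule add_increasing[OF exp_ge_zero])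
        then show ?thesis using True by (auto split: split_indicator simp del: exp_le_one_iff)
      next
        case False
        then have "C \<le> r (T * n)" by auto
        then show ?thesis using False C(1) p by auto
      qed
    qed (use p even_quasi_subadditiveD(1)[OF r] in \<open>auto intro!: N.integrable_const_bound[of _ 1] Bochner_Integration.integrable_add\<close>)
    also have "\<dots> = exp (- (p * C)) + measure std_normal_distribution ?A + measure std_normal_distribution ?B"
      using N.prob_space by (subst Bochner_Integration.integral_add; (subst Bochner_Integration.integral_add)?)
        (auto intro!: N.integrable_const_bound[of _ 1] Bochner_Integration.integrable_add)
    also have "measure std_normal_distribution ?B \<le> measure lborel ?B"
    proof (rule std_normal_measure_le_lborel)
      have "emeasure lborel ?B \<le> emeasure lborel {-L..L}" by (intro emeasure_mono) auto
      also have "\<dots> < \<infinity>" using L(1) by (simp add: emeasure_lborel_Icc)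
      finally show "emeasure lborel ?B < \<infinity>" .
    qed measurable
    finally show ?case using elim L C by linarith
  qed
next
  fix a :: real assume "a < 0"
  then show "eventually (\<lambda>T. a < (LINT n|std_normal_distribution. exp (- (p * r (T * n))))) at_top"
    by (intro always_eventually allI less_le_trans[OF _ Bochner_Integration.integral_nonneg]) auto
qed

text \<open>The exponent of the limit is finite everywhere because its characteristic function does not vanish:
  it does not vanish near 0, and quasi-subadditivity bounds its modulus at \<open>2 s\<close> below by the fourth
  power of its modulus at \<open>s\<close>.\<close>
lemma limit_even_quasi_subadditive_exponent:
  assumes \<mu>: "\<And>k. real_distribution (\<mu> k)" and W: "real_distribution W"
    and conv: "weak_conv_m \<mu> W"
    and r: "\<And>k. even_quasi_subadditive (r k)"
    and ch: "\<And>k s. cmod (char (\<mu> k) s) = exp (- r k s)"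
  obtains \<rho> where "even_quasi_subadditive \<rho>" "\<rho> \<in> borel_measurable borel"
    "\<And>s. cmod (char W s) = exp (- \<rho> s)"
proof -
  interpret W: real_distribution W by fact
  have lim: "(\<lambda>k. exp (- r k s)) \<longlonglongrightarrow> cmod (char W s)" for s
    using tendsto_norm[OF levy_continuity1[OF \<mu> W conv, of s]] by (simp add: ch)
  have double: "cmod (char W s) ^ 4 \<le> cmod (char W (2 * s))" for s
  proof (rule LIMSEQ_le[OF tendsto_power[OF lim] lim], intro exI allI impI)
    fix k
    have "r k (2 * s) \<le> 4 * r k s"
      using even_quasi_subadditiveD(3)[OF r[of k], of s s] by (simp flip: mult_2)
    then show "exp (- r k s) ^ 4 \<le> exp (- r k (2 * s))"
      by (simp flip: exp_of_nat_mult)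
  qed
  have nz: "0 < cmod (char W s)" for s
  proof -
    have "(\<lambda>n. s / 2 ^ n) \<longlonglongrightarrow> 0" by real_asymp
    then have "(\<lambda>n. cmod (char W (s / 2 ^ n))) \<longlonglongrightarrow> cmod (char W 0)"
      using W.isCont_char[of 0] by (intro tendsto_norm isCont_tendsto_compose[of 0 "char W"])
    then have "eventually (\<lambda>n. 0 < cmod (char W (s / 2 ^ n))) sequentially"
      using W.char_zero by (intro order_tendstoD(1)) auto
    then obtain n where "0 < cmod (char W (s / 2 ^ n))" by (auto simp: eventually_sequentially)
    then show ?thesis
    proof (induction n)
      case (Suc n)
      have "0 < cmod (char W (s / 2 ^ Suc n)) ^ 4" using Suc.prems by simp
      also have "\<dots> \<le> cmod (char W (s / 2 ^ n))" using double[of "s / 2 ^ Suc n"] by simp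
      finally show ?case by (rule Suc.IH)
    qed simp
  qed
  define \<rho> where "\<rho> s = - ln (cmod (char W s))" for s
  have "(\<lambda>k. - ln (exp (- r k s))) \<longlonglongrightarrow> \<rho> s" for s
    unfolding \<rho>_def using nz[of s] by (intro tendsto_intros lim) auto
  then have lim\<rho>: "(\<lambda>k. r k s) \<longlonglongrightarrow> \<rho> s" for s by simp
  have nonneg: "0 \<le> r k s" for k s using r[of k] by (simp add: even_quasi_subadditive_def)
  have "even_quasi_subadditive \<rho>"
    unfolding even_quasi_subadditive_def
  proof (intro conjI allI)
    fix x y
    show "0 \<le> \<rho> x" by (rule LIMSEQ_le_const[OF lim\<rho>]) (use nonneg in auto)
    have "(\<lambda>k. r k (- x)) = (\<lambda>k. r k x)" using r by (simp add: even_quasi_subadditive_def)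
    then show "\<rho> (- x) = \<rho> x" using LIMSEQ_unique[OF lim\<rho>[of "- x"]] lim\<rho>[of x] by simp
    show "\<rho> (x + y) \<le> 2 * \<rho> x + 2 * \<rho> y"
      by (rule LIMSEQ_le[OF lim\<rho> tendsto_add[OF tendsto_mult_left[OF lim\<rho>] tendsto_mult_left[OF lim\<rho>]]]) (use r in \<open>auto simp: even_quasi_subadditive_def\<close>)
  qed
  moreover have "\<rho> \<in> borel_measurable borel" unfolding \<rho>_def by measurable
  moreover have "cmod (char W s) = exp (- \<rho> s)" for s
    using nz[of s] W.cmod_char_le_1[of s] unfolding \<rho>_def by simp
  ultimately show thesis using that by blast
qed

section \<open>Limits under a centered norming\<close>
definition rescale :: "real \<Rightarrow> real measure \<Rightarrow> real measure" where
  "rescale b D = distr D borel (\<lambda>x. x / b)"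

lemma real_distribution_rescale:
  assumes "real_distribution D" shows "real_distribution (rescale b D)"
proof -
  interpret real_distribution D by fact
  show ?thesis unfolding rescale_def by (intro real_distribution_distr) measurable
qed

lemma char_rescale:
  assumes "real_distribution D" shows "char (rescale b D) s = char D (s / b)"
proof -
  interpret real_distribution D by fact
  have "(\<lambda>x. x / b) \<in> borel_measurable D" by measurable
  then show ?thesis unfolding char_def rescale_def by (subst integral_distr) auto
qed

lemma measure_rescale:
  assumes "real_distribution D" and "A \<in> sets borel"
  shows "measure (rescale b D) A = measure D {x. x / b \<in> A}"
proof -
  interpret real_distribution D by fact
  have "(\<lambda>x. x / b) \<in> borel_measurable D" by measurable
  then show ?thesis unfolding rescale_def using assms(2) by (subst measure_distr) (auto simp: vimage_def)
qed

lemma time_sequence_subseq: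
  "time_sequence G t \<Longrightarrow> strict_mono q \<Longrightarrow> time_sequence G (\<lambda>k. t (q k))"
  unfolding time_sequence_def by (auto intro: filterlim_compose[OF _ filterlim_subseq])

lemma time_sequence_at_right_iff:
  assumes "\<And>k. 0 < t k"
  shows "time_sequence (at_right 0) t \<longleftrightarrow> t \<longlonglongrightarrow> 0"
  using assms unfolding time_sequence_def filterlim_at by (simp add: less_imp_neq[symmetric])

lemma time_sequence_scale:
  assumes G: "G = at_right 0 \<or> G = at_top" and t: "time_sequence G t" and c: "c > 0"
  shows "time_sequence G (\<lambda>k. c * t k)"
  using G
proof
  assume G: "G = at_right 0"
  have pos: "0 < t k" for k using t by (simp add: time_sequence_def)
  have "t \<longlonglongrightarrow> 0" using t time_sequence_at_right_iff[OF pos] unfolding G by simp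
  then have "(\<lambda>k. c * t k) \<longlonglongrightarrow> 0" by (rule tendsto_mult_right_zero)
  then show ?thesis using c pos unfolding G by (subst time_sequence_at_right_iff) auto
next
  assume G: "G = at_top"
  then show ?thesis using t c unfolding time_sequence_def
    by (auto intro!: filterlim_tendsto_pos_mult_at_top[OF tendsto_const])
qed

text \<open>Row \<open>m\<close> of the array consists of the times \<open>t k / (m + 1)\<close>. Choosing \<open>\<kappa> m\<close> large makes the diagonal
  converge to the limit point as well, so that finitely many asymptotic properties of each row can be
  collected into one time sequence.\<close>
lemma time_sequence_diagonal:
  assumes G: "G = at_right 0 \<or> G = at_top" and t: "time_sequence G t"
    and P: "\<And>m::nat. eventually (\<lambda>k. P m k) sequentially"
  obtains \<kappa> where "time_sequence G (\<lambda>m. t (\<kappa> m) / real (Suc m))" "\<And>m. P m (\<kappa> m)"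
proof -
  have pos: "0 < t k" for k using t by (simp add: time_sequence_def)
  show thesis
    using G
  proof
    assume G: "G = at_right 0"
    have "t \<longlonglongrightarrow> 0" using t time_sequence_at_right_iff[OF pos] unfolding G by simp
    then have "eventually (\<lambda>k. t k < 1 \<and> P m k) sequentially" for m
      using P[of m] by (intro eventually_conj order_tendstoD(2)) auto
    then have "\<exists>k. t k < 1 \<and> P m k" for m by (auto simp: eventually_sequentially)
    then obtain \<kappa> where \<kappa>: "\<And>m. t (\<kappa> m) < 1" "\<And>m. P m (\<kappa> m)" by metis
    have "(\<lambda>m. t (\<kappa> m) / real (Suc m)) \<longlonglongrightarrow> 0"
    proof (rule real_tendsto_sandwich[OF _ _ tendsto_const])
      show "(\<lambda>m. 1 / real (Suc m)) \<longlonglongrightarrow> 0" by real_asymp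
    qed (use pos \<kappa>(1) in \<open>auto intro!: always_eventually divide_right_mono simp: less_imp_le simp del: of_nat_Suc\<close>)
    then have "time_sequence G (\<lambda>m. t (\<kappa> m) / real (Suc m))"
      using pos unfolding G by (subst time_sequence_at_right_iff) (auto intro: divide_pos_pos)
    then show thesis using \<kappa>(2) that by blast
  next
    assume G: "G = at_top"
    have "filterlim t at_top sequentially" using t unfolding G time_sequence_def by simp
    then have "eventually (\<lambda>k. real m * real (Suc m) \<le> t k \<and> P m k) sequentially" for m
      using P[of m] unfolding filterlim_at_top by (intro eventually_conj) auto
    then have "\<exists>k. real m * real (Suc m) \<le> t k \<and> P m k" for m by (auto simp: eventually_sequentially)
    then obtain \<kappa> where \<kappa>: "\<And>m. real m * real (Suc m) \<le> t (\<kappa> m)" "\<And>m. P m (\<kappa> m)" by metis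
    have "filterlim (\<lambda>m. t (\<kappa> m) / real (Suc m)) at_top sequentially"
      by (rule filterlim_at_top_mono[OF filterlim_real_sequentially])
         (use \<kappa>(1) in \<open>auto intro!: always_eventually simp: pos_le_divide_eq simp del: of_nat_Suc\<close>)
    then have "time_sequence G (\<lambda>m. t (\<kappa> m) / real (Suc m))"
      using pos unfolding G time_sequence_def by simp
    then show thesis using \<kappa>(2) that by blast
  qed
qed

text \<open>The centered Feller property of a process, expressed through its one-dimensional laws \<open>\<nu> t\<close>.\<close>
definition compact_norming :: "real filter \<Rightarrow> (real \<Rightarrow> real measure) \<Rightarrow> (real \<Rightarrow> real) \<Rightarrow> bool" where
  "compact_norming G \<nu> B \<longleftrightarrow> (\<forall>t>0. B t > 0) \<and>
    (\<forall>t. time_sequence G t \<longrightarrow>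
      (\<exists>r \<mu>. strict_mono r \<and> real_distribution \<mu> \<and> nondegenerate \<mu> \<and>
         weak_conv_m (\<lambda>k. rescale (B (t (r k))) (\<nu> (t (r k)))) \<mu>))"

lemma compact_normingE:
  assumes "compact_norming G \<nu> B" "time_sequence G t"
  obtains r \<mu> where "strict_mono r" "real_distribution \<mu>" "nondegenerate \<mu>"
    "weak_conv_m (\<lambda>k. rescale (B (t (r k))) (\<nu> (t (r k)))) \<mu>"
  using assms unfolding compact_norming_def by blast

lemma subseq_of_exceptions:
  assumes "\<not> eventually P sequentially"
  obtains q :: "nat \<Rightarrow> nat" where "strict_mono q" "\<And>k. \<not> P (q k)"
proof -
  have "infinite {k. \<not> P k}"
    using assms by (metis eventually_cofinite cofinite_eq_sequentially)
  then show thesis using infinite_enumerate[of "{k. \<not> P k}"] that by blast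
qed

text \<open>Divide the times by \<open>m + 1\<close> and call the ratio of the old to the new norming \<open>x k\<close>. Up to the dilation
  by \<open>x k\<close>, the modulus for the new times raised to the power \<open>m + 1\<close> is the modulus for the old times.
  Where the dilations stay bounded this transfers the lower bound. They cannot tend to infinity, since
  then the law at the old times would be the sum of \<open>m + 1\<close> negligible parts.\<close>
lemma char_fraction_bounded_below:
  fixes \<nu> :: "real \<Rightarrow> real measure"
  assumes G: "G = at_right 0 \<or> G = at_top"
    and \<nu>: "\<And>t. t > 0 \<Longrightarrow> real_distribution (\<nu> t)"
    and ch: "\<And>t s. t > 0 \<Longrightarrow> cmod (char (\<nu> t) s) = exp (- (t * h s))"
    and B: "compact_norming G \<nu> B"
    and t: "time_sequence G t" and W: "real_distribution W" "nondegenerate W"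
    and conv: "weak_conv_m (\<lambda>k. rescale (B (t k)) (\<nu> (t k))) W"
    and \<epsilon>: "\<epsilon> > 0" "\<And>s. \<epsilon> \<le> cmod (char W s)"
  shows "eventually (\<lambda>k. \<epsilon> / 2 <
    cmod (char (rescale (B (t k / real (Suc m))) (\<nu> (t k / real (Suc m)))) s) ^ Suc m) sequentially"
    (is "eventually ?P sequentially")
proof (rule ccontr)
  let ?m = "real (Suc m)"
  have mpos: "0 < ?m" by simp
  have tpos: "0 < t k" for k using t by (simp add: time_sequence_def)
  have Bpos: "0 < B (t k)" "0 < B (t k / ?m)" for k
    using B tpos[of k] mpos by (simp_all add: compact_norming_def)
  assume "\<not> eventually ?P sequentially"
  from subseq_of_exceptions[OF this] obtain q :: "nat \<Rightarrow> nat" where q: "strict_mono q" and bad: "\<And>k. \<not> ?P (q k)" by blast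
  have "time_sequence G (\<lambda>k. (1 / ?m) * t (q k))" (is "time_sequence G ?t")
    by (rule time_sequence_scale[OF G time_sequence_subseq[OF t q]]) (simp del: of_nat_Suc)
  from compact_normingE[OF B this] obtain r :: "nat \<Rightarrow> nat" and V where r: "strict_mono r"
    and V: "real_distribution V" "nondegenerate V"
    and convV: "weak_conv_m (\<lambda>k. rescale (B (?t (r k))) (\<nu> (?t (r k)))) V" .
  define p where "p k = q (r k)" for k
  have p: "strict_mono p" using q r unfolding p_def strict_mono_def by blast
  define X where "X k = rescale (B (t (p k))) (\<nu> (t (p k)))" for k
  define Y where "Y k = rescale (B (t (p k) / ?m)) (\<nu> (t (p k) / ?m))" for k
  define x where "x k = B (t (p k)) / B (t (p k) / ?m)" for k
  have xpos: "0 < x k" for k unfolding x_def using Bpos by simp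
  have Xd: "real_distribution (X k)" and Yd: "real_distribution (Y k)" for k
    unfolding X_def Y_def using tpos mpos by (auto intro!: real_distribution_rescale \<nu>)
  have convX: "weak_conv_m X W" unfolding X_def using weak_conv_m_subseq[OF conv p] .
  have convY: "weak_conv_m Y V" unfolding Y_def p_def using convV by simp
  have XY: "cmod (char (Y k) s) ^ Suc m = cmod (char (X k) (s * x k))" for k s
  proof -
    have "cmod (char (Y k) s) ^ Suc m = exp (- (t (p k) / ?m * h (s / B (t (p k) / ?m)))) ^ Suc m"
      unfolding Y_def using tpos[of "p k"] mpos by (simp add: char_rescale \<nu> ch del: of_nat_Suc)
    also have "\<dots> = exp (?m * (- (t (p k) / ?m * h (s / B (t (p k) / ?m)))))"
      by (rule exp_of_nat_mult[symmetric])
    also have "\<dots> = exp (- (t (p k) * h (s / B (t (p k) / ?m))))"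
      using mpos by (simp del: of_nat_Suc)
    also have "\<dots> = cmod (char (X k) (s * x k))"
      unfolding X_def x_def using tpos[of "p k"] Bpos(1)[of "p k"] by (simp add: char_rescale \<nu> ch)
    finally show ?thesis .
  qed
  have bad': "cmod (char (X k) (s * x k)) \<le> \<epsilon> / 2" for k
    using bad[of "r k"] XY[of k s] unfolding Y_def p_def by simp
  show False
  proof (cases "filterlim x at_top sequentially")
    case True
    \<comment> \<open>the smaller time has negligible norming, so the limit \<open>W\<close> carries no randomness\<close>
    have "cmod (char W s') = 1" for s'
    proof -
      have "(\<lambda>k. s' / x k) \<longlonglongrightarrow> 0"
        by (rule tendsto_divide_0[OF tendsto_const filterlim_at_top_imp_at_infinity[OF True]])
      then have "(\<lambda>k. cmod (char (Y k) (s' / x k)) ^ Suc m) \<longlonglongrightarrow> cmod (char V 0) ^ Suc m"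
        by (intro tendsto_power tendsto_norm char_tendsto_moving_argument Yd V convY)
      moreover have "cmod (char (Y k) (s' / x k)) ^ Suc m = cmod (char (X k) s')" for k
        unfolding XY using xpos[of k] by simp
      ultimately have "(\<lambda>k. cmod (char (X k) s')) \<longlonglongrightarrow> 1"
        using real_distribution.char_zero[OF V(1)] by simp
      then show ?thesis
        using tendsto_norm[OF levy_continuity1[OF Xd W(1) convX]] LIMSEQ_unique by blast
    qed
    then show False using degenerate_if_norm_char_eq_1[OF W(1)] W(2) by blast
  next
    case False
    then obtain K where K: "\<not> eventually (\<lambda>k. K \<le> x k) sequentially"
      unfolding filterlim_at_top by blast
    from subseq_of_exceptions[OF this] obtain w :: "nat \<Rightarrow> nat" where w: "strict_mono w" "\<And>k. \<not> K \<le> x (w k)" by blast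
    have "x (w k) \<in> {0..K}" for k using w(2)[of k] xpos[of "w k"] by auto
    then obtain \<xi> v where v: "strict_mono v" "((\<lambda>k. x (w k)) \<circ> v) \<longlonglongrightarrow> \<xi>"
      using compact_imp_seq_compact[OF compact_Icc, of 0 K] unfolding seq_compact_def by metis
    have "(\<lambda>k. s * x (w (v k))) \<longlonglongrightarrow> s * \<xi>"
      using v(2) by (intro tendsto_mult_left) (simp add: comp_def)
    then have "(\<lambda>k. cmod (char (X (w (v k))) (s * x (w (v k))))) \<longlonglongrightarrow> cmod (char W (s * \<xi>))"
      using w(1) v(1) weak_conv_m_subseq[OF weak_conv_m_subseq[OF convX w(1)] v(1)]
      by (intro tendsto_norm char_tendsto_moving_argument Xd W(1))
    then have "cmod (char W (s * \<xi>)) \<le> \<epsilon> / 2"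
      by (rule LIMSEQ_le_const2) (use bad' in auto)
    then show False using \<epsilon>(2)[of "s * \<xi>"] \<epsilon>(1) by simp
  qed
qed

text \<open>Under a lower bound \<open>\<epsilon>\<close>, the modulus for the times divided by \<open>m + 1\<close> is eventually at least the root
  of order \<open>m + 1\<close> of \<open>\<epsilon> / 2\<close>, which tends to 1. Along a diagonal sequence this produces a degenerate
  limit, contradicting the norming.\<close>
lemma char_of_limit_not_bounded_below:
  fixes \<nu> :: "real \<Rightarrow> real measure"
  assumes G: "G = at_right 0 \<or> G = at_top"
    and \<nu>: "\<And>t. t > 0 \<Longrightarrow> real_distribution (\<nu> t)"
    and ch: "\<And>t s. t > 0 \<Longrightarrow> cmod (char (\<nu> t) s) = exp (- (t * h s))"
    and B: "compact_norming G \<nu> B"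
    and t: "time_sequence G t" and W: "real_distribution W" "nondegenerate W"
    and conv: "weak_conv_m (\<lambda>k. rescale (B (t k)) (\<nu> (t k))) W"
    and \<epsilon>: "\<epsilon> > 0"
  shows "\<exists>s. cmod (char W s) < \<epsilon>"
proof (rule ccontr)
  assume "\<not> (\<exists>s. cmod (char W s) < \<epsilon>)"
  then have low: "\<epsilon> \<le> cmod (char W s)" for s by (meson not_less)
  let ?Y = "\<lambda>t. rescale (B t) (\<nu> t)"
  let ?P = "\<lambda>m k. \<forall>j\<in>{..m}. \<epsilon> / 2 < cmod (char (?Y (t k / real (Suc m))) (1 / 2 ^ j)) ^ Suc m"
  have P: "eventually (?P m) sequentially" for m
    by (intro eventually_ball_finite ballI char_fraction_bounded_below[OF G \<nu> ch B t W conv \<epsilon> low]) auto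
  obtain \<kappa> where \<tau>: "time_sequence G (\<lambda>m. t (\<kappa> m) / real (Suc m))"
    and \<kappa>: "\<And>m. \<forall>j\<in>{..m}. \<epsilon> / 2 < cmod (char (?Y (t (\<kappa> m) / real (Suc m))) (1 / 2 ^ j)) ^ Suc m"
    using time_sequence_diagonal[OF G t, of ?P, OF P] by blast
  define \<tau> where "\<tau> m = t (\<kappa> m) / real (Suc m)" for m
  have \<tau>pos: "0 < \<tau> m" for m using \<tau> unfolding \<tau>_def time_sequence_def by blast
  have Yd: "real_distribution (?Y (\<tau> m))" for m by (intro real_distribution_rescale \<nu> \<tau>pos)
  have "time_sequence G \<tau>" using \<tau> unfolding \<tau>_def .
  from compact_normingE[OF B this] obtain r Z where r: "strict_mono r"
    and Z: "real_distribution Z" "nondegenerate Z"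
    and convZ: "weak_conv_m (\<lambda>k. ?Y (\<tau> (r k))) Z" .
  have "cmod (char Z (1 / 2 ^ j)) = 1" for j :: nat
  proof (rule antisym)
    show "cmod (char Z (1 / 2 ^ j)) \<le> 1" by (rule real_distribution.cmod_char_le_1[OF Z(1)])
    have "(\<lambda>m. root (Suc m) (\<epsilon> / 2)) \<longlonglongrightarrow> 1"
      using LIMSEQ_Suc[OF LIMSEQ_root_const[of "\<epsilon> / 2"]] \<epsilon> by simp
    then have 1: "(\<lambda>k. root (Suc (r k)) (\<epsilon> / 2)) \<longlonglongrightarrow> 1"
      using LIMSEQ_subseq_LIMSEQ[OF _ r] by (force simp: comp_def)
    have 2: "(\<lambda>k. cmod (char (?Y (\<tau> (r k))) (1 / 2 ^ j))) \<longlonglongrightarrow> cmod (char Z (1 / 2 ^ j))"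
      by (intro tendsto_norm levy_continuity1 Yd Z convZ)
    show "1 \<le> cmod (char Z (1 / 2 ^ j))"
    proof (rule LIMSEQ_le[OF 1 2], intro exI allI impI)
      fix k assume "j \<le> k"
      then have "j \<in> {..r k}" using seq_suble[OF r, of k] by simp
      then have "\<epsilon> / 2 \<le> cmod (char (?Y (\<tau> (r k))) (1 / 2 ^ j)) ^ Suc (r k)"
        using \<kappa>[of "r k"] unfolding \<tau>_def by (meson less_imp_le)
      then have "root (Suc (r k)) (\<epsilon> / 2) \<le> root (Suc (r k)) (cmod (char (?Y (\<tau> (r k))) (1 / 2 ^ j)) ^ Suc (r k))"
        by (intro real_root_le_mono) auto
      then show "root (Suc (r k)) (\<epsilon> / 2) \<le> cmod (char (?Y (\<tau> (r k))) (1 / 2 ^ j))"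
        by (subst (asm) real_root_power_cancel) auto
    qed
  qed
  then show False using degenerate_if_norm_char_eq_1[OF Z(1)] Z(2) by blast
qed

text \<open>The measure \<open>Q\<close> describes the multipliers \<open>y\<close> of the jumps. The Gaussian mean bounds the mass of \<open>D k\<close> near
  0; letting \<open>k\<close> tend to infinity replaces \<open>\<mu> k\<close> by \<open>W\<close>, and for each \<open>y \<noteq> 0\<close> the remaining mean of
  \<open>exp (- p r(T n y))\<close> over \<open>n\<close> vanishes as \<open>T\<close> grows. The power \<open>p\<close> leaves room for multipliers that
  are nonzero only with probability \<open>p\<close>.\<close>
lemma concentration_near_0:
  fixes \<mu> D :: "nat \<Rightarrow> real measure"
  assumes \<mu>: "\<And>k. real_distribution (\<mu> k)" and W: "real_distribution W" and conv: "weak_conv_m \<mu> W"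
    and r: "even_quasi_subadditive r" and r_meas[measurable]: "r \<in> borel_measurable borel"
    and chW: "\<And>s. cmod (char W s) = exp (- r s)" and unb: "\<And>C. \<exists>u. C < r u"
    and Q: "real_distribution Q" and Q0: "AE y in Q. y \<noteq> 0" and p: "p > 0"
    and D: "\<And>k. real_distribution (D k)"
    and chD: "\<And>k \<theta>. cmod (char (D k) \<theta>) \<le> (LINT y|Q. cmod (char (\<mu> k) (\<theta> * y)) powr p)"
    and \<epsilon>: "\<epsilon> > 0"
  obtains \<delta> where "\<delta> > 0" "eventually (\<lambda>k. measure (D k) {x. \<bar>x\<bar> \<le> \<delta>} < \<epsilon>) sequentially"
proof -
  interpret N: real_distribution std_normal_distribution by (rule real_dist_normal_dist)
  interpret Q: real_distribution Q by fact
  interpret P: pair_prob_space std_normal_distribution Q ..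
  have [measurable]: "char (\<mu> k) \<in> borel_measurable borel" "char (D k) \<in> borel_measurable borel" for k
    by (intro real_distribution.char_measurable \<mu> D)+
  have powr_le: "cmod (char (\<mu> k) x) powr p \<le> 1" for k x
    using real_distribution.cmod_char_le_1[OF \<mu>, of k x] p by (intro powr_le1) auto
  let ?f = "\<lambda>k T n y. cmod (char (\<mu> k) (T * n * y)) powr p"
  let ?g = "\<lambda>T n y. exp (- (p * r (T * n * y)))"
  have lim_f: "(\<lambda>k. ?f k T n y) \<longlonglongrightarrow> ?g T n y" for T n y
  proof -
    have "cmod (char W (T * n * y)) \<noteq> 0" unfolding chW by simp
    then have "(\<lambda>k. ?f k T n y) \<longlonglongrightarrow> cmod (char W (T * n * y)) powr p"
      by (intro tendsto_powr tendsto_norm levy_continuity1[OF \<mu> W conv] tendsto_const)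
    then show ?thesis by (simp add: chW powr_def mult.commute)
  qed
  have lim_k: "(\<lambda>k. LINT n|std_normal_distribution. LINT y|Q. ?f k T n y)
      \<longlonglongrightarrow> (LINT n|std_normal_distribution. LINT y|Q. ?g T n y)" for T
  proof (rule integral_dominated_convergence[where w="\<lambda>_. 1"])
    have "(\<lambda>k. LINT y|Q. ?f k T n y) \<longlonglongrightarrow> (LINT y|Q. ?g T n y)" for n
      by (rule integral_dominated_convergence[where w="\<lambda>_. 1"])
         (auto intro!: AE_I2 lim_f powr_le)
    then show "AE n in std_normal_distribution. (\<lambda>k. LINT y|Q. ?f k T n y) \<longlonglongrightarrow> (LINT y|Q. ?g T n y)"
      by simp
    show "AE n in std_normal_distribution. norm (LINT y|Q. ?f k T n y) \<le> 1" for k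
    proof (rule AE_I2)
      fix n
      have "norm (LINT y|Q. ?f k T n y) \<le> (LINT y|Q. norm (?f k T n y))" by (rule integral_norm_bound)
      also have "\<dots> \<le> 1" by (rule Q.integral_le_const) (auto intro!: Q.integrable_const_bound[of _ 1] powr_le)
      finally show "norm (LINT y|Q. ?f k T n y) \<le> 1" .
    qed
  qed auto
  have swap: "(LINT n|std_normal_distribution. LINT y|Q. ?g T n y)
      = (LINT y|Q. LINT n|std_normal_distribution. ?g T n y)" for T
    by (rule P.Fubini_integral[symmetric])
       (use p even_quasi_subadditiveD(1)[OF r] in \<open>auto intro!: P.integrable_const_bound[of _ 1] simp: split_beta'\<close>)
  have "(\<lambda>j. LINT y|Q. LINT n|std_normal_distribution. ?g (real (Suc j)) n y) \<longlonglongrightarrow> (LINT y|Q. 0)"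
  proof (rule integral_dominated_convergence[where w="\<lambda>_. 1"])
    show "AE y in Q. (\<lambda>j. LINT n|std_normal_distribution. ?g (real (Suc j)) n y) \<longlonglongrightarrow> 0"
      using Q0
    proof eventually_elim
      case (elim y)
      have "filterlim (\<lambda>j. real (Suc j) * \<bar>y\<bar>) at_top sequentially"
        using elim by real_asymp
      then have "(\<lambda>j. LINT n|std_normal_distribution. exp (- (p * r (real (Suc j) * \<bar>y\<bar> * n)))) \<longlonglongrightarrow> 0"
        by (rule filterlim_compose[OF gaussian_mean_exp_tendsto_0[OF r_meas r unb p]])
      moreover have "r (real (Suc j) * \<bar>y\<bar> * n) = r (real (Suc j) * n * y)" for j n
      proof (cases "y \<ge> 0")
        case False
        then have "real (Suc j) * \<bar>y\<bar> * n = - (real (Suc j) * n * y)" by simp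
        then show ?thesis using r unfolding even_quasi_subadditive_def by metis
      qed (simp add: mult_ac)
      ultimately show ?case by simp
    qed
    show "AE y in Q. norm (LINT n|std_normal_distribution. ?g (real (Suc j)) n y) \<le> 1" for j
    proof (rule AE_I2)
      fix y
      have "norm (LINT n|std_normal_distribution. ?g (real (Suc j)) n y)
          \<le> (LINT n|std_normal_distribution. norm (?g (real (Suc j)) n y))" by (rule integral_norm_bound)
      also have "\<dots> \<le> 1"
        by (rule N.integral_le_const) (use p even_quasi_subadditiveD(1)[OF r] in \<open>auto intro!: N.integrable_const_bound[of _ 1]\<close>)
      finally show "norm (LINT n|std_normal_distribution. ?g (real (Suc j)) n y) \<le> 1" .
    qed
  qed auto
  then have "eventually (\<lambda>j. (LINT y|Q. LINT n|std_normal_distribution. ?g (real (Suc j)) n y) < \<epsilon> / 2) sequentially"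
    using \<epsilon> by (intro order_tendstoD(2)) auto
  then obtain j where j: "(LINT y|Q. LINT n|std_normal_distribution. ?g (real (Suc j)) n y) < \<epsilon> / 2"
    by (auto simp: eventually_sequentially)
  define T where "T = real (Suc j)"
  have T: "T > 0" unfolding T_def by simp
  have "(LINT n|std_normal_distribution. LINT y|Q. ?g T n y) < \<epsilon> / 2"
    using j unfolding swap T_def .
  then have "eventually (\<lambda>k. (LINT n|std_normal_distribution. LINT y|Q. ?f k T n y) < \<epsilon> / 2) sequentially"
    by (rule order_tendstoD(2)[OF lim_k])
  then have "eventually (\<lambda>k. measure (D k) {x. \<bar>x\<bar> \<le> 1 / T} < \<epsilon>) sequentially"
  proof eventually_elim
    case (elim k)
    have "measure (D k) {x. \<bar>x\<bar> \<le> 1 / T} \<le> 2 * (LINT n|std_normal_distribution. cmod (char (D k) (T * n)))"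
      by (rule measure_near_0_le_gaussian_mean_of_char[OF D T])
    also have "(LINT n|std_normal_distribution. cmod (char (D k) (T * n)))
        \<le> (LINT n|std_normal_distribution. LINT y|Q. ?f k T n y)"
    proof (intro integral_mono chD)
      show "integrable std_normal_distribution (\<lambda>n. cmod (char (D k) (T * n)))"
        using real_distribution.cmod_char_le_1[OF D] by (intro N.integrable_const_bound[of _ 1]) auto
      show "integrable std_normal_distribution (\<lambda>n. LINT y|Q. ?f k T n y)"
        by (rule P.integrable_fst) (auto intro!: P.integrable_const_bound[of _ 1] powr_le simp: split_beta')
    qed
    finally show ?case using elim by simp
  qed
  then show thesis using T by (intro that[of "1 / T"]) auto
qed

section \<open>The Levy exponent and the laws of linear combinations\<close>
definition levy_exponent :: "real measure \<Rightarrow> real \<Rightarrow> complex" where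
  "levy_exponent \<Lambda> \<theta> = (CLINT v|\<Lambda>. iexp (\<theta> * v) - 1)"

definition levy_decay :: "real measure \<Rightarrow> real \<Rightarrow> real" where
  "levy_decay \<Lambda> \<theta> = - Re (levy_exponent \<Lambda> \<theta>)"

lemma norm_iexp_minus_1_le: "cmod (iexp (\<theta> * v) - 1) \<le> (2 + \<bar>\<theta>\<bar>) * min 1 \<bar>v\<bar>"
proof (cases "\<bar>v\<bar> \<le> 1")
  case True
  have "cmod (iexp (\<theta> * v) - 1) \<le> \<bar>\<theta>\<bar> * \<bar>v\<bar>"
    using iexp_approx1[of "\<theta> * v" 0] by (simp add: abs_mult)
  also have "\<dots> \<le> (2 + \<bar>\<theta>\<bar>) * \<bar>v\<bar>" by (intro mult_right_mono) auto
  finally show ?thesis using True by simp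
next
  case False
  have "cmod (iexp (\<theta> * v) - 1) \<le> cmod (iexp (\<theta> * v)) + cmod 1" by (rule norm_triangle_ineq4)
  also have "\<dots> = 2" by simp
  finally show ?thesis using False by simp
qed

context
  fixes \<Lambda> :: "real measure"
  assumes \<Lambda>: "subordinator_levy_measure \<Lambda>"
begin

lemma sets_levy [measurable_cong]: "sets \<Lambda> = sets borel"
  using \<Lambda> by (simp add: subordinator_levy_measure_def levy_measure_def)

lemma space_levy: "space \<Lambda> = UNIV"
  using sets_eq_imp_space_eq[OF sets_levy] by simp

lemma AE_levy_pos: "AE v in \<Lambda>. 0 < v"
proof (rule AE_I'[of "{..0}"])
  show "{..0} \<in> null_sets \<Lambda>"
    using \<Lambda> sets_levy by (auto simp: subordinator_levy_measure_def null_sets_def)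
qed (auto simp: not_less)

lemma integrable_min_1_levy: "integrable \<Lambda> (\<lambda>v. min 1 \<bar>v\<bar>)"
proof (rule integrableI_bounded)
  have "(\<integral>\<^sup>+v. ennreal (norm (min 1 \<bar>v\<bar> :: real)) \<partial>\<Lambda>)
      \<le> (\<integral>\<^sup>+v. ennreal v * indicator {0..1} v + ennreal (min 1 (v\<^sup>2)) \<partial>\<Lambda>)"
  proof (rule nn_integral_mono_AE)
    show "AE v in \<Lambda>. ennreal (norm (min 1 \<bar>v\<bar> :: real)) \<le> ennreal v * indicator {0..1} v + ennreal (min 1 (v\<^sup>2))"
      using AE_levy_pos
    proof eventually_elim
      case (elim v)
      show ?case
      proof (cases "v \<le> 1")
        case False
        then have "1 \<le> v\<^sup>2" by (simp add: one_le_power)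
        then show ?thesis using False by simp
      qed (use elim in simp)
    qed
  qed
  also have "\<dots> = (\<integral>\<^sup>+v\<in>{0..1}. ennreal v \<partial>\<Lambda>) + (\<integral>\<^sup>+v. ennreal (min 1 (v\<^sup>2)) \<partial>\<Lambda>)"
    by (intro nn_integral_add) measurable
  also have "\<dots> < \<infinity>"
    using \<Lambda> by (simp add: subordinator_levy_measure_def levy_measure_def)
  finally show "(\<integral>\<^sup>+v. ennreal (norm (min 1 \<bar>v\<bar> :: real)) \<partial>\<Lambda>) < \<infinity>" .
qed measurable

lemma levy_tail_le:
  assumes "0 < a" "a \<le> 1"
  shows "emeasure \<Lambda> {a<..} \<le> ennreal ((LINT v|\<Lambda>. min 1 \<bar>v\<bar>) / a)"
proof -
  have "emeasure \<Lambda> {a<..} = (\<integral>\<^sup>+v. indicator {a<..} v \<partial>\<Lambda>)"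
    by (subst nn_integral_indicator) (auto simp: sets_levy)
  also have "\<dots> \<le> (\<integral>\<^sup>+v. ennreal (min 1 \<bar>v\<bar> / a) \<partial>\<Lambda>)"
  proof (rule nn_integral_mono)
    fix v
    show "indicator {a<..} v \<le> ennreal (min 1 \<bar>v\<bar> / a)"
      using assms by (auto split: split_indicator simp: field_simps min_def)
  qed
  also have "\<dots> = ennreal (LINT v|\<Lambda>. min 1 \<bar>v\<bar> / a)"
    by (rule nn_integral_eq_integral) (use integrable_min_1_levy assms in auto)
  finally show ?thesis by simp
qed

lemma sigma_finite_levy: "sigma_finite_measure \<Lambda>"
proof
  let ?A = "insert {..0} (range (\<lambda>n::nat. {1 / real (Suc n)<..}))"
  have "x \<in> \<Union> ?A" for x
    using reals_Archimedean[of x] by (cases "x \<le> 0") (auto simp: inverse_eq_divide)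
  then have "\<Union> ?A = space \<Lambda>" unfolding space_levy by blast
  moreover have "emeasure \<Lambda> {1 / real (Suc n)<..} \<noteq> \<infinity>" for n :: nat
    using levy_tail_le[of "1 / real (Suc n)"] by (auto simp: top_unique)
  moreover have "emeasure \<Lambda> {..0} \<noteq> \<infinity>"
    using \<Lambda> by (simp add: subordinator_levy_measure_def)
  ultimately show "\<exists>A. countable A \<and> A \<subseteq> sets \<Lambda> \<and> \<Union> A = space \<Lambda> \<and> (\<forall>a\<in>A. emeasure \<Lambda> a \<noteq> \<infinity>)"
    by (intro exI[of _ ?A]) (auto simp: sets_levy)
qed

lemma set_integral_levy_pos:
  fixes f :: "real \<Rightarrow> 'b::{banach, second_countable_topology}"
  assumes [measurable]: "f \<in> borel_measurable borel"
  shows "(LINT v:{0<..}|\<Lambda>. f v) = (LINT v|\<Lambda>. f v)"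
  unfolding set_lebesgue_integral_def
  by (rule integral_cong_AE) (use AE_levy_pos in \<open>auto elim!: eventually_mono\<close>)

lemma integrable_iexp_minus_1_levy: "integrable \<Lambda> (\<lambda>v. iexp (\<theta> * v) - 1)"
  by (rule Bochner_Integration.integrable_bound[OF integrable_mult_right[OF integrable_min_1_levy, of "2 + \<bar>\<theta>\<bar>"]])
     (use norm_iexp_minus_1_le[of \<theta>] in \<open>auto intro!: AE_I2 simp: abs_mult\<close>)

lemma norm_levy_exponent_le:
  "cmod (levy_exponent \<Lambda> \<theta>) \<le> (2 + \<bar>\<theta>\<bar>) * (LINT v|\<Lambda>. min 1 \<bar>v\<bar>)"
proof -
  have "cmod (levy_exponent \<Lambda> \<theta>) \<le> (LINT v|\<Lambda>. (2 + \<bar>\<theta>\<bar>) * min 1 \<bar>v\<bar>)"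
    unfolding levy_exponent_def
    by (intro order_trans[OF integral_norm_bound integral_mono] integrable_norm
      integrable_iexp_minus_1_levy integrable_mult_right integrable_min_1_levy norm_iexp_minus_1_le)
  then show ?thesis by simp
qed

lemma levy_exponent_measurable [measurable]: "levy_exponent \<Lambda> \<in> borel_measurable borel"
proof -
  interpret sigma_finite_measure \<Lambda> by (rule sigma_finite_levy)
  show ?thesis unfolding levy_exponent_def by measurable
qed

lemma levy_decay_eq: "levy_decay \<Lambda> \<theta> = (LINT v|\<Lambda>. 1 - cos (\<theta> * v))"
proof -
  have "Re (levy_exponent \<Lambda> \<theta>) = (LINT v|\<Lambda>. Re (iexp (\<theta> * v) - 1))"
    unfolding levy_exponent_def by (rule integral_Re[OF integrable_iexp_minus_1_levy, symmetric])
  then show ?thesis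
    unfolding levy_decay_def by (simp add: Re_exp flip: Bochner_Integration.integral_minus)
qed

lemma integrable_1_minus_cos_levy: "integrable \<Lambda> (\<lambda>v. 1 - cos (\<theta> * v))"
  using integrable_minus[OF integrable_Re[OF integrable_iexp_minus_1_levy[of \<theta>]]] by (simp add: Re_exp)

lemma levy_decay_even_quasi_subadditive: "even_quasi_subadditive (levy_decay \<Lambda>)"
  unfolding even_quasi_subadditive_def
proof (intro conjI allI)
  fix x y
  show "0 \<le> levy_decay \<Lambda> x"
    unfolding levy_decay_eq by (intro Bochner_Integration.integral_nonneg) auto
  show "levy_decay \<Lambda> (- x) = levy_decay \<Lambda> x" by (simp add: levy_decay_eq)
  have ineq: "1 - cos (a + b) \<le> 2 * (1 - cos a) + 2 * (1 - cos b)" for a b :: real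
  proof -
    have *: "1 - cos u = 2 * (sin (u / 2))\<^sup>2" for u :: real
      using cos_double_sin[of "u / 2"] by simp
    have "\<bar>sin (a / 2 + b / 2)\<bar> \<le> \<bar>sin (a / 2) * cos (b / 2)\<bar> + \<bar>cos (a / 2) * sin (b / 2)\<bar>"
      unfolding sin_add by (rule abs_triangle_ineq)
    also have "\<dots> \<le> \<bar>sin (a / 2)\<bar> + \<bar>sin (b / 2)\<bar>"
      by (intro add_mono) (simp_all add: abs_mult mult_left_le mult_left_le_one_le)
    finally have "\<bar>sin ((a + b) / 2)\<bar> \<le> \<bar>sin (a / 2)\<bar> + \<bar>sin (b / 2)\<bar>" by (simp add: add_divide_distrib)
    then have "(sin ((a + b) / 2))\<^sup>2 \<le> (\<bar>sin (a / 2)\<bar> + \<bar>sin (b / 2)\<bar>)\<^sup>2"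
      by (subst power2_abs[symmetric]) (intro power_mono; simp)
    also have "\<dots> \<le> 2 * (sin (a / 2))\<^sup>2 + 2 * (sin (b / 2))\<^sup>2"
      using sum_squares_bound[of "\<bar>sin (a / 2)\<bar>" "\<bar>sin (b / 2)\<bar>"] by (simp add: power2_sum)
    finally show ?thesis unfolding * by simp
  qed
  have "levy_decay \<Lambda> (x + y) \<le> (LINT v|\<Lambda>. 2 * (1 - cos (x * v)) + 2 * (1 - cos (y * v)))"
    unfolding levy_decay_eq using ineq
    by (intro integral_mono Bochner_Integration.integrable_add integrable_mult_right integrable_1_minus_cos_levy)
       (auto simp: distrib_right)
  also have "\<dots> = 2 * levy_decay \<Lambda> x + 2 * levy_decay \<Lambda> y"
    unfolding levy_decay_eq
    by (subst Bochner_Integration.integral_add, (intro integrable_mult_right integrable_1_minus_cos_levy)+)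
       (simp only: integral_mult_right_zero)
  finally show "levy_decay \<Lambda> (x + y) \<le> 2 * levy_decay \<Lambda> x + 2 * levy_decay \<Lambda> y" .
qed

lemma integrable_levy_exponent_affine:
  assumes F: "finite_mean_distribution F"
  shows "integrable F (\<lambda>x. levy_exponent \<Lambda> (\<theta> * (a * x + b)))"
proof -
  interpret F: real_distribution F using F by (simp add: finite_mean_distribution_def)
  have [measurable]: "(\<lambda>x. levy_exponent \<Lambda> (\<theta> * (a * x + b))) \<in> borel_measurable F" by measurable
  have int: "integrable F (\<lambda>x. (2 + \<bar>\<theta> * (a * x + b)\<bar>) * (LINT v|\<Lambda>. min 1 \<bar>v\<bar>))"
    using F unfolding finite_mean_distribution_def
    by (intro integrable_mult_left Bochner_Integration.integrable_add integrable_abs integrable_mult_right) auto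
  show ?thesis
    by (rule Bochner_Integration.integrable_bound[OF int])
       (auto intro!: AE_I2 order_trans[OF norm_levy_exponent_le])
qed

lemma randomly_weighted_pair_measurable:
  assumes "randomly_weighted_pair \<Lambda> F M U V" "0 \<le> t"
  shows "prob_space M" "U t \<in> borel_measurable M" "V t \<in> borel_measurable M"
proof -
  have lp: "levy_process M (\<lambda>t \<omega>. (U t \<omega>, V t \<omega>))"
    using assms by (simp add: randomly_weighted_pair_def)
  then show "prob_space M" by (simp add: levy_process_def)
  have *: "(\<lambda>\<omega>. (U t \<omega>, V t \<omega>)) \<in> borel_measurable M"
    using lp assms(2) by (simp add: levy_process_def)
  show "U t \<in> borel_measurable M" "V t \<in> borel_measurable M"
    using measurable_compose[OF *, of fst borel] measurable_compose[OF *, of snd borel]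
    by (auto simp: borel_prod[symmetric])
qed

text \<open>The jumps of \<open>a U + b V\<close> are those of \<open>V\<close> multiplied by independent copies of \<open>a X + b\<close>; finiteness of
  \<open>E |X|\<close> permits exchanging the two integrals.\<close>
lemma char_linear_combination:
  assumes UV: "randomly_weighted_pair \<Lambda> F M U V" and F: "finite_mean_distribution F" and t: "0 \<le> t"
  shows "char (distr M borel (\<lambda>\<omega>. a * U t \<omega> + b * V t \<omega>)) \<theta>
    = exp (complex_of_real t * (CLINT x|F. levy_exponent \<Lambda> (\<theta> * (a * x + b))))"
proof -
  interpret F: real_distribution F using F by (simp add: finite_mean_distribution_def)
  interpret L: sigma_finite_measure \<Lambda> by (rule sigma_finite_levy)
  interpret P: pair_sigma_finite F \<Lambda> ..
  note [measurable] = randomly_weighted_pair_measurable(2,3)[OF UV t]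
  let ?f = "\<lambda>x v. iexp (\<theta> * (a * x + b) * v) - 1"
  have "integrable (F \<Otimes>\<^sub>M \<Lambda>) (\<lambda>(x, v). ?f x v)"
  proof (rule P.Fubini_integrable)
    have int: "integrable F (\<lambda>x. (2 + \<bar>\<theta> * (a * x + b)\<bar>) * (LINT v|\<Lambda>. min 1 \<bar>v\<bar>))"
      using F unfolding finite_mean_distribution_def
      by (intro integrable_mult_left Bochner_Integration.integrable_add integrable_abs integrable_mult_right) auto
    show "integrable F (\<lambda>x. LINT v|\<Lambda>. cmod (case (x, v) of (x, v) \<Rightarrow> ?f x v))"
    proof (rule Bochner_Integration.integrable_bound[OF int])
      show "AE x in F. norm (LINT v|\<Lambda>. cmod (case (x, v) of (x, v) \<Rightarrow> ?f x v))
          \<le> norm ((2 + \<bar>\<theta> * (a * x + b)\<bar>) * (LINT v|\<Lambda>. min 1 \<bar>v\<bar>))"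
      proof (rule AE_I2)
        fix x
        have "(LINT v|\<Lambda>. cmod (?f x v)) \<le> (LINT v|\<Lambda>. (2 + \<bar>\<theta> * (a * x + b)\<bar>) * min 1 \<bar>v\<bar>)"
          using norm_iexp_minus_1_le[of "\<theta> * (a * x + b)"]
          by (intro integral_mono integrable_norm integrable_iexp_minus_1_levy integrable_mult_right integrable_min_1_levy)
        then show "norm (LINT v|\<Lambda>. cmod (case (x, v) of (x, v) \<Rightarrow> ?f x v))
          \<le> norm ((2 + \<bar>\<theta> * (a * x + b)\<bar>) * (LINT v|\<Lambda>. min 1 \<bar>v\<bar>))"
          by (simp add: abs_mult)
      qed
    qed measurable
    show "AE x in F. integrable \<Lambda> (\<lambda>v. case (x, v) of (x, v) \<Rightarrow> ?f x v)"
      unfolding prod.case by (intro AE_I2 integrable_iexp_minus_1_levy)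
  qed measurable
  then have swap: "(CLINT v|\<Lambda>. CLINT x|F. ?f x v) = (CLINT x|F. CLINT v|\<Lambda>. ?f x v)"
    by (rule P.Fubini_integral)
  have m: "(\<lambda>\<omega>. a * U t \<omega> + b * V t \<omega>) \<in> borel_measurable M" by measurable
  have "char (distr M borel (\<lambda>\<omega>. a * U t \<omega> + b * V t \<omega>)) \<theta>
      = (CLINT \<omega>|M. iexp (\<theta> * (a * U t \<omega> + b * V t \<omega>)))"
    unfolding char_def by (subst integral_distr[OF m]) auto
  also have "\<dots> = (CLINT \<omega>|M. iexp (\<theta> * a * U t \<omega> + \<theta> * b * V t \<omega>))"
    by (simp add: algebra_simps)
  also have "\<dots> = exp (complex_of_real t *
      (CLINT v:{0<..}|\<Lambda>. (CLINT x|F. iexp (\<theta> * a * (x * v) + \<theta> * b * v) - 1)))"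
    using UV t unfolding randomly_weighted_pair_def by blast
  also have "(CLINT v:{0<..}|\<Lambda>. (CLINT x|F. iexp (\<theta> * a * (x * v) + \<theta> * b * v) - 1))
      = (CLINT v|\<Lambda>. (CLINT x|F. iexp (\<theta> * a * (x * v) + \<theta> * b * v) - 1))"
    by (rule set_integral_levy_pos) measurable
  also have "\<dots> = (CLINT v|\<Lambda>. (CLINT x|F. ?f x v))"
    by (simp add: algebra_simps)
  finally show ?thesis unfolding swap levy_exponent_def .
qed

end

section \<open>Centered Feller processes have continuous ratio limits\<close>
lemma rescale_distr:
  assumes [measurable]: "X \<in> borel_measurable M"
  shows "rescale b (distr M borel X) = distr M borel (\<lambda>\<omega>. X \<omega> / b)"
  unfolding rescale_def by (subst distr_distr) (auto simp: comp_def)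

lemma continuous_distribution_iff_no_atoms:
  assumes "real_distribution \<mu>"
  shows "continuous_distribution \<mu> \<longleftrightarrow> (\<forall>c. measure \<mu> {c} = 0)"
proof -
  interpret real_distribution \<mu> by fact
  show ?thesis
    unfolding continuous_distribution_def continuous_on_eq_continuous_at[OF open_UNIV] using isCont_cdf by simp
qed

text \<open>\<open>Q\<close> is the conditional law of \<open>X - c\<close> given \<open>X \<noteq> c\<close>, and \<open>p\<close> is the probability of this event. Jumps
  with \<open>X = c\<close> contribute nothing to \<open>U - c V\<close>, so its spread comes from this part of \<open>F\<close>.\<close>
lemma conditional_law_of_deviation:
  assumes F: "real_distribution F" "nondegenerate F"
  obtains Q p where "real_distribution Q" "AE y in Q. y \<noteq> (0::real)" "p > 0"
    "\<And>f :: real \<Rightarrow> real. integrable F (\<lambda>x. f (x - c)) \<Longrightarrow> f \<in> borel_measurable borel \<Longrightarrow> f 0 = 0 \<Longrightarrow>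
       integrable Q f \<and> (LINT x|F. f (x - c)) = p * (LINT y|Q. f y)"
proof -
  interpret F: real_distribution F by fact
  define A where "A = - {c}"
  have [measurable]: "A \<in> sets borel" unfolding A_def by auto
  define p where "p = measure F A"
  have "p \<noteq> 0"
    using F(2) F.prob_compl[of "{c}"] unfolding p_def A_def nondegenerate_def by (auto simp: Compl_eq_Diff_UNIV)
  then have p: "p > 0" unfolding p_def by (simp add: zero_less_measure_iff)
  define R where "R = density F (\<lambda>x. ennreal (indicator A x / p))"
  have "emeasure R (space R) = (\<integral>\<^sup>+x. ennreal (1 / p) * indicator A x \<partial>F)"
    unfolding R_def by (subst emeasure_density) (auto intro!: nn_integral_cong split: split_indicator)
  also have "\<dots> = ennreal (1 / p) * ennreal p"
    unfolding p_def by (subst nn_integral_cmult_indicator) (auto simp: F.emeasure_eq_measure)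
  also have "\<dots> = 1" using p by (simp flip: ennreal_mult')
  finally interpret R: prob_space R by (rule prob_spaceI)
  have setsR: "sets R = sets borel" unfolding R_def by simp
  define Q where "Q = distr R borel (\<lambda>x. x - c)"
  have m: "(\<lambda>x. x - c) \<in> borel_measurable R"
    unfolding measurable_cong_sets[OF setsR refl] by measurable
  show thesis
  proof (rule that[of Q p])
    show "real_distribution Q" unfolding Q_def by (rule R.real_distribution_distr[OF m])
    have "AE x in R. x - c \<noteq> 0"
      unfolding R_def by (subst AE_density) (auto intro!: AE_I2 simp: A_def split: split_indicator)
    then show "AE y in Q. y \<noteq> 0" unfolding Q_def by (subst AE_distr_iff[OF m]) auto
    show "p > 0" by fact
    fix f :: "real \<Rightarrow> real"
    assume int: "integrable F (\<lambda>x. f (x - c))" and [measurable]: "f \<in> borel_measurable borel" and f0: "f 0 = 0"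
    have *: "(indicator A x / p) *\<^sub>R f (x - c) = f (x - c) / p" for x
      using f0 by (auto simp: A_def split: split_indicator)
    have "integrable R (\<lambda>x. f (x - c))"
      unfolding R_def using p int by (subst integrable_density) (auto simp: * simp del: real_scaleR_def)
    moreover have "(LINT x|R. f (x - c)) = (LINT x|F. f (x - c)) / p"
      unfolding R_def using p by (subst integral_density) (auto simp: * simp del: real_scaleR_def)
    ultimately show "integrable Q f \<and> (LINT x|F. f (x - c)) = p * (LINT y|Q. f y)"
      unfolding Q_def using p by (simp add: integrable_distr_eq[OF m] integral_distr[OF m])
  qed
qed

lemma exp_neg_integral_le:
  assumes "prob_space Q" "integrable Q g" "\<And>y. 0 \<le> g y"
  shows "exp (- (LINT y|Q. g y)) \<le> (LINT y|Q. exp (- g y) :: real)"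
proof -
  interpret prob_space Q by fact
  have [measurable]: "g \<in> borel_measurable Q" using assms(2) by auto
  have "exp (LINT y|Q. - g y) \<le> (LINT y|Q. exp (- g y))"
  proof (rule jensens_inequality[where I=UNIV])
    show "integrable Q (\<lambda>y. exp (- g y))"
      using assms(3) by (intro integrable_const_bound[of _ 1]) auto
    show "convex_on UNIV (exp :: real \<Rightarrow> real)" by (rule exp_convex)
  qed (use assms(2) in auto)
  then show ?thesis by simp
qed

text \<open>On the event that \<open>U/V\<close> is within \<open>\<delta>\<^sub>1 / K\<close> of \<open>c\<close>, one of three things happens:
  \<open>|V| > K B\<close>, or \<open>|V| \<le> \<delta>\<^sub>2 B\<close>, or \<open>|U - c V| \<le> \<delta>\<^sub>1 B\<close>. Each has small probability, the first by
  tightness and the other two by \<open>concentration_near_0\<close>.\<close>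
theorem ratio_limit_continuous_if_compact_norming:
  assumes G: "G = at_right 0 \<or> G = at_top"
    and \<Lambda>: "subordinator_levy_measure \<Lambda>" and UV: "randomly_weighted_pair \<Lambda> F M U V"
    and F: "F \<in> class_X" and B: "compact_norming G (\<lambda>t. distr M borel (V t)) B"
    and lim: "subsequential_ratio_limit G M U V \<mu>"
  shows "continuous_distribution \<mu>"
proof -
  have Fm: "finite_mean_distribution F" and Fnd: "nondegenerate F" using F by (auto simp: class_X_def)
  then have Fd: "real_distribution F" by (simp add: finite_mean_distribution_def)
  interpret F: real_distribution F by fact
  have \<mu>: "real_distribution \<mu>" using lim by (simp add: subsequential_ratio_limit_def)
  interpret \<mu>: real_distribution \<mu> by fact
  interpret M: prob_space M by (rule randomly_weighted_pair_measurable(1)[OF \<Lambda> UV order_refl])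
  obtain t where t: "time_sequence G t"
    and convR: "weak_conv_m (\<lambda>k. distr M borel (\<lambda>\<omega>. U (t k) \<omega> / V (t k) \<omega>)) \<mu>"
    using lim unfolding subsequential_ratio_limit_def by blast
  from compact_normingE[OF B t] obtain r W where r: "strict_mono r"
    and W: "real_distribution W" "nondegenerate W"
    and convW: "weak_conv_m (\<lambda>k. rescale (B (t (r k))) (distr M borel (V (t (r k))))) W" .
  define s where "s k = t (r k)" for k
  define b where "b k = B (s k)" for k
  have s: "time_sequence G s" unfolding s_def by (rule time_sequence_subseq[OF t r])
  then have spos: "0 < s k" for k by (simp add: time_sequence_def)
  have bpos: "0 < b k" for k using B spos unfolding b_def compact_norming_def by blast
  have meas: "U t \<in> borel_measurable M" "V t \<in> borel_measurable M" if "t > 0" for t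
    using randomly_weighted_pair_measurable(2,3)[OF \<Lambda> UV] that by auto
  note [measurable] = meas[OF spos]
  let ?h = "levy_decay \<Lambda>"
  note h = levy_decay_even_quasi_subadditive[OF \<Lambda>]
  have h0: "?h 0 = 0" unfolding levy_decay_def levy_exponent_def by simp
  have Vd: "real_distribution (distr M borel (V t))" if "t > 0" for t
    using meas(2)[OF that] by (rule M.real_distribution_distr)
  have chV: "cmod (char (distr M borel (V t)) \<theta>) = exp (- (t * ?h \<theta>))" if "t > 0" for t \<theta>
    using char_linear_combination[OF \<Lambda> UV Fm, of t 0 1 \<theta>] that F.prob_space
    by (simp add: levy_decay_def)
  define X where "X k = distr M borel (\<lambda>\<omega>. V (s k) \<omega> / b k)" for k
  have X: "X k = rescale (b k) (distr M borel (V (s k)))" for k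
    unfolding X_def by (subst rescale_distr) auto
  have Xd: "real_distribution (X k)" for k unfolding X by (intro real_distribution_rescale Vd spos)
  have convX: "weak_conv_m X W" using convW unfolding X b_def s_def .
  let ?g = "\<lambda>k \<theta>. s k * ?h (\<theta> / b k)"
  have gq: "even_quasi_subadditive (?g k)" for k
    unfolding even_quasi_subadditive_def
  proof (intro conjI allI)
    fix x y
    show "0 \<le> ?g k x" using even_quasi_subadditiveD(1)[OF h] spos[of k] by simp
    show "?g k (- x) = ?g k x" using even_quasi_subadditiveD(2)[OF h, of "x / b k"] by simp
    have "?h ((x + y) / b k) \<le> 2 * ?h (x / b k) + 2 * ?h (y / b k)"
      unfolding add_divide_distrib by (rule even_quasi_subadditiveD(3)[OF h])
    then have "s k * ?h ((x + y) / b k) \<le> s k * (2 * ?h (x / b k) + 2 * ?h (y / b k))"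
      using spos[of k] by (intro mult_left_mono) auto
    then show "?g k (x + y) \<le> 2 * ?g k x + 2 * ?g k y" by (simp add: algebra_simps)
  qed
  have chX: "cmod (char (X k) \<theta>) = exp (- ?g k \<theta>)" for k \<theta>
    unfolding X by (simp add: char_rescale Vd spos chV)
  obtain \<rho> where \<rho>: "even_quasi_subadditive \<rho>" "\<rho> \<in> borel_measurable borel"
    and chW: "\<And>\<theta>. cmod (char W \<theta>) = exp (- \<rho> \<theta>)"
    using limit_even_quasi_subadditive_exponent[OF Xd W(1) convX gq chX] by blast
  have unb: "\<exists>u. C < \<rho> u" for C
    using char_of_limit_not_bounded_below[OF G Vd chV B s W convX[unfolded X b_def], of "exp (- C)"]
    by (simp add: chW)
  have *: "measure \<mu> {c} \<le> 3 * \<epsilon>" if \<epsilon>: "\<epsilon> > 0" for c \<epsilon>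
  proof -
    obtain Q p where Q: "real_distribution Q" "AE y in Q. y \<noteq> (0::real)" and p: "p > 0"
      and shift: "\<And>f :: real \<Rightarrow> real. integrable F (\<lambda>x. f (x - c)) \<Longrightarrow> f \<in> borel_measurable borel \<Longrightarrow> f 0 = 0 \<Longrightarrow>
         integrable Q f \<and> (LINT x|F. f (x - c)) = p * (LINT y|Q. f y)"
      using conditional_law_of_deviation[OF Fd Fnd] by blast
    interpret Q: real_distribution Q by fact
    define D where "D k = distr M borel (\<lambda>\<omega>. 1 / b k * U (s k) \<omega> + (- c / b k) * V (s k) \<omega>)" for k
    have Dd: "real_distribution (D k)" for k unfolding D_def by (intro M.real_distribution_distr) measurable
    have chD: "cmod (char (D k) \<theta>) \<le> (LINT y|Q. cmod (char (X k) (\<theta> * y)) powr p)" for k \<theta>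
    proof -
      have int: "integrable F (\<lambda>x. levy_exponent \<Lambda> (\<theta> * (1 / b k * x + - c / b k)))"
        by (rule integrable_levy_exponent_affine[OF \<Lambda> Fm])
      have "cmod (char (D k) \<theta>) = exp (s k * Re (CLINT x|F. levy_exponent \<Lambda> (\<theta> * (1 / b k * x + - c / b k))))"
        unfolding D_def using spos[of k] by (subst char_linear_combination[OF \<Lambda> UV Fm]) auto
      also have "Re (CLINT x|F. levy_exponent \<Lambda> (\<theta> * (1 / b k * x + - c / b k)))
          = (LINT x|F. - ?h (\<theta> * (1 / b k * x + - c / b k)))"
        unfolding levy_decay_def minus_minus by (rule integral_Re[OF int, symmetric])
      also have "\<dots> = - (LINT x|F. ?h (\<theta> * (1 / b k * x + - c / b k)))" by simp
      also have "s k * \<dots> = - (LINT x|F. ?g k (\<theta> * (x - c)))"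
        by (simp add: diff_divide_distrib algebra_simps)
      finally have 1: "cmod (char (D k) \<theta>) = exp (- (LINT x|F. ?g k (\<theta> * (x - c))))" .
      have hm [measurable]: "?h \<in> borel_measurable borel"
        unfolding levy_decay_def[abs_def] using levy_exponent_measurable[OF \<Lambda>] by measurable
      have "integrable F (\<lambda>x. ?h (\<theta> * (1 / b k * x + - c / b k)))"
        unfolding levy_decay_def by (intro integrable_minus integrable_Re int)
      then have "integrable F (\<lambda>x. s k * ?h (\<theta> * (1 / b k * x + - c / b k)))" by (rule integrable_mult_right)
      then have "integrable F (\<lambda>x. ?g k (\<theta> * (x - c)))"
        by (simp add: diff_divide_distrib algebra_simps)
      then have 2: "integrable Q (\<lambda>y. ?g k (\<theta> * y))"
        "(LINT x|F. ?g k (\<theta> * (x - c))) = p * (LINT y|Q. ?g k (\<theta> * y))"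
        using shift[of "\<lambda>y. ?g k (\<theta> * y)"] h0 by auto
      \<comment> \<open>Jensen's inequality turns the averaged exponent into an average of moduli\<close>
      have "exp (- (LINT y|Q. p * ?g k (\<theta> * y))) \<le> (LINT y|Q. exp (- (p * ?g k (\<theta> * y))))"
        using 2(1) p even_quasi_subadditiveD(1)[OF gq[of k]]
        by (intro exp_neg_integral_le Q.prob_space_axioms integrable_mult_right) auto
      moreover have "exp (- (p * ?g k (\<theta> * y))) = cmod (char (X k) (\<theta> * y)) powr p" for y
        by (simp add: chX powr_def)
      ultimately show ?thesis unfolding 1 2 by simp
    qed
    obtain \<delta>1 where \<delta>1: "\<delta>1 > 0" "eventually (\<lambda>k. measure (D k) {x. \<bar>x\<bar> \<le> \<delta>1} < \<epsilon>) sequentially"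
      using concentration_near_0[OF Xd W(1) convX \<rho> chW unb Q p Dd chD \<epsilon>] by blast
    obtain \<delta>2 where \<delta>2: "\<delta>2 > 0" "eventually (\<lambda>k. measure (X k) {x. \<bar>x\<bar> \<le> \<delta>2} < \<epsilon>) sequentially"
    proof (rule concentration_near_0[OF Xd W(1) convX \<rho> chW unb _ _ zero_less_one Xd _ \<epsilon>])
      interpret P1: prob_space "return borel (1::real)" by (rule prob_space_return) simp
      show "real_distribution (return borel (1::real))"
        by standard simp
      show "AE y in return borel (1::real). y \<noteq> 0" by (subst AE_return) auto
      show "cmod (char (X k) \<theta>) \<le> (LINT y|return borel 1. cmod (char (X k) (\<theta> * y)) powr 1)" for k \<theta>
        using real_distribution.char_measurable[OF Xd[of k]] by (subst integral_return) auto
    qed (use that in blast)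
    obtain K where K: "K > 0" "eventually (\<lambda>k. measure (X k) {x. \<bar>x\<bar> > K} < \<epsilon>) sequentially"
      using weak_conv_m_imp_eventually_tight[OF Xd W(1) convX \<epsilon>] by blast
    define \<delta> where "\<delta> = \<delta>1 / K"
    have \<delta>: "\<delta> > 0" unfolding \<delta>_def using \<delta>1 K by simp
    define f where "f x = max 0 (1 - \<bar>x - c\<bar> / \<delta>)" for x
    have f01: "0 \<le> f x" "f x \<le> 1" for x unfolding f_def using \<delta> by auto
    have [measurable]: "f \<in> borel_measurable borel" unfolding f_def by measurable
    define Z where "Z k = distr M borel (\<lambda>\<omega>. U (s k) \<omega> / V (s k) \<omega>)" for k
    have Zd: "real_distribution (Z k)" for k unfolding Z_def by (intro M.real_distribution_distr) measurable
    have convZ: "weak_conv_m Z \<mu>" unfolding Z_def s_def using weak_conv_m_subseq[OF convR r] .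
    have "(\<lambda>k. LINT x|Z k. f x) \<longlonglongrightarrow> (LINT x|\<mu>. f x)"
      by (rule weak_conv_imp_integral_bdd_continuous_conv[OF Zd \<mu> convZ, where B=1])
         (use f01 \<delta> in \<open>auto simp: f_def intro!: continuous_intros\<close>)
    moreover have "eventually (\<lambda>k. (LINT x|Z k. f x) \<le> 3 * \<epsilon>) sequentially"
      using \<delta>1(2) \<delta>2(2) K(2)
    proof eventually_elim
      case (elim k)
      let ?S1 = "{\<omega> \<in> space M. \<bar>1 / b k * U (s k) \<omega> + (- c / b k) * V (s k) \<omega>\<bar> \<le> \<delta>1}"
      let ?S2 = "{\<omega> \<in> space M. \<bar>V (s k) \<omega> / b k\<bar> \<le> \<delta>2}"
      let ?S3 = "{\<omega> \<in> space M. \<bar>V (s k) \<omega> / b k\<bar> > K}"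
      have sets: "?S1 \<in> sets M" "?S2 \<in> sets M" "?S3 \<in> sets M" by measurable
      have S: "measure M ?S1 < \<epsilon>" "measure M ?S2 < \<epsilon>" "measure M ?S3 < \<epsilon>"
        using elim unfolding D_def X_def by (simp_all add: measure_distr vimage_def Int_def conj_commute)
      have "(LINT x|Z k. f x) = (LINT \<omega>|M. f (U (s k) \<omega> / V (s k) \<omega>))"
        unfolding Z_def by (subst integral_distr) auto
      also have "\<dots> \<le> (LINT \<omega>|M. indicator (?S1 \<union> ?S2 \<union> ?S3) \<omega>)"
      proof (intro integral_mono)
        fix \<omega> assume \<omega>: "\<omega> \<in> space M"
        show "f (U (s k) \<omega> / V (s k) \<omega>) \<le> indicator (?S1 \<union> ?S2 \<union> ?S3) \<omega>"
        proof (cases "\<bar>U (s k) \<omega> / V (s k) \<omega> - c\<bar> < \<delta> \<and> V (s k) \<omega> \<noteq> 0 \<and> \<bar>V (s k) \<omega> / b k\<bar> \<le> K")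
          case True
          have "1 / b k * U (s k) \<omega> + (- c / b k) * V (s k) \<omega>
              = (U (s k) \<omega> / V (s k) \<omega> - c) * (V (s k) \<omega> / b k)"
            using True bpos[of k] by (simp add: field_simps)
          also have "\<bar>\<dots>\<bar> = \<bar>U (s k) \<omega> / V (s k) \<omega> - c\<bar> * \<bar>V (s k) \<omega> / b k\<bar>" by (rule abs_mult)
          also have "\<dots> \<le> \<delta> * K" using True \<delta> by (intro mult_mono) auto
          finally have "\<omega> \<in> ?S1" using \<omega> K unfolding \<delta>_def by simp
          then show ?thesis using f01(2) by simp
        next
          case False
          have "f x = 0" if "\<not> \<bar>x - c\<bar> < \<delta>" for x
            using that \<delta> unfolding f_def by (simp add: field_simps max_def)
          moreover have "V (s k) \<omega> = 0 \<Longrightarrow> \<omega> \<in> ?S2" "\<not> \<bar>V (s k) \<omega> / b k\<bar> \<le> K \<Longrightarrow> \<omega> \<in> ?S3"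
            using \<omega> \<delta>2(1) by auto
          ultimately consider "f (U (s k) \<omega> / V (s k) \<omega>) = 0" | "\<omega> \<in> ?S2 \<or> \<omega> \<in> ?S3"
            using False by blast
          then show ?thesis using f01(2) by cases (auto simp: indicator_def)
        qed
      qed (use f01 sets in \<open>auto intro!: M.integrable_const_bound[of _ 1]\<close>)
      also have "\<dots> = measure M (?S1 \<union> ?S2 \<union> ?S3)" using sets by simp
      also have "\<dots> \<le> measure M ?S1 + measure M ?S2 + measure M ?S3"
        using sets by (intro order_trans[OF measure_Un_le] add_right_mono measure_Un_le) auto
      finally show ?case using S by linarith
    qed
    ultimately have "(LINT x|\<mu>. f x) \<le> 3 * \<epsilon>" by (rule tendsto_upperbound) simp
    moreover have "measure \<mu> {c} = (LINT x|\<mu>. indicator {c} x)" by simp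
    moreover have "\<dots> \<le> (LINT x|\<mu>. f x)"
      by (intro integral_mono \<mu>.integrable_const_bound[of _ 1])
         (use f01 in \<open>auto split: split_indicator simp: f_def\<close>)
    ultimately show ?thesis by linarith
  qed
  have "measure \<mu> {c} = 0" for c
  proof (rule antisym)
    show "measure \<mu> {c} \<le> 0"
    proof (rule field_le_epsilon)
      fix e :: real assume "0 < e"
      then show "measure \<mu> {c} \<le> 0 + e" using *[of "e / 3" c] by simp
    qed
  qed simp
  then show ?thesis using continuous_distribution_iff_no_atoms[OF \<mu>] by blast
qed

section \<open>Nonnegativity of the subordinator\<close>
definition nonneg_char :: "(real \<Rightarrow> complex) \<Rightarrow> bool" where
  "nonneg_char \<phi> \<longleftrightarrow> (\<exists>D. real_distribution D \<and> (AE x in D. 0 \<le> x) \<and> char D = \<phi>)"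

lemma nonneg_char_1: "nonneg_char (\<lambda>_. 1)"
proof -
  interpret D: prob_space "return borel (0::real)" by (rule prob_space_return) simp
  have "real_distribution (return borel (0::real))" by standard simp
  moreover have "AE x in return borel (0::real). 0 \<le> x" by (subst AE_return) auto
  moreover have "char (return borel 0) = (\<lambda>_. 1)"
    unfolding char_def by (intro ext) (subst integral_return; simp)
  ultimately show ?thesis unfolding nonneg_char_def by blast
qed

lemma borel_measurable_pair:
  assumes "sets A = sets A'" "sets B = sets B'" "f \<in> borel_measurable (A' \<Otimes>\<^sub>M B')"
  shows "f \<in> borel_measurable (A \<Otimes>\<^sub>M B)"
  using assms(3) measurable_cong_sets[OF sets_pair_measure_cong[OF assms(1,2)] refl] by blast

lemma nonneg_char_mult:
  assumes "nonneg_char \<phi>" "nonneg_char \<psi>"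
  shows "nonneg_char (\<lambda>\<theta>. \<phi> \<theta> * \<psi> \<theta>)"
proof -
  obtain D E where D: "real_distribution D" "AE x in D. 0 \<le> x" "char D = \<phi>"
    and E: "real_distribution E" "AE x in E. 0 \<le> x" "char E = \<psi>"
    using assms unfolding nonneg_char_def by blast
  interpret D: real_distribution D by fact
  interpret E: real_distribution E by fact
  interpret P: pair_prob_space D E ..
  let ?S = "distr (D \<Otimes>\<^sub>M E) borel (\<lambda>z. 1 * fst z + 1 * snd z)"
  have m: "(\<lambda>z. 1 * fst z + 1 * snd z) \<in> borel_measurable (D \<Otimes>\<^sub>M E)"
    by (rule borel_measurable_pair[OF D.events_eq_borel E.events_eq_borel]) measurable
  have "AE z in D \<Otimes>\<^sub>M E. 0 \<le> fst z + snd z"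
  proof (rule P.AE_pair_measure)
    show "AE x in D. AE y in E. 0 \<le> fst (x, y) + snd (x, y)"
      using D(2) by eventually_elim (use E(2) in eventually_elim, simp)
    show "{z \<in> space (D \<Otimes>\<^sub>M E). 0 \<le> fst z + snd z} \<in> sets (D \<Otimes>\<^sub>M E)"
      using m by (intro borel_measurable_le) auto
  qed
  then have "AE x in ?S. 0 \<le> x" by (subst AE_distr_iff[OF m]) auto
  moreover have "char ?S = (\<lambda>\<theta>. \<phi> \<theta> * \<psi> \<theta>)"
    using char_pair_linear[OF D(1) E(1), of 1 1] D(3) E(3) by auto
  ultimately show ?thesis
    using real_distribution_pair_linear[OF D(1) E(1), of 1 1] unfolding nonneg_char_def by blast
qed

lemma nonneg_char_power: "nonneg_char \<phi> \<Longrightarrow> nonneg_char (\<lambda>\<theta>. \<phi> \<theta> ^ n)"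
  by (induction n) (simp_all add: nonneg_char_1 nonneg_char_mult)

lemma norm_nonneg_char_le_1: "nonneg_char \<phi> \<Longrightarrow> cmod (\<phi> \<theta>) \<le> 1"
  using real_distribution.cmod_char_le_1 unfolding nonneg_char_def by blast

lemma nonneg_char_limit:
  assumes D: "real_distribution D" and \<phi>: "\<And>n. nonneg_char (\<phi> n)"
    and lim: "\<And>\<theta>. (\<lambda>n. \<phi> n \<theta>) \<longlonglongrightarrow> char D \<theta>"
  shows "AE x in D. 0 \<le> x"
proof -
  interpret D: real_distribution D by fact
  obtain E where E: "\<And>n. real_distribution (E n)" "\<And>n. AE x in E n. 0 \<le> x" "\<And>n. char (E n) = \<phi> n"
    using \<phi> unfolding nonneg_char_def by metis
  let ?f = "\<lambda>x::real. min 1 (max 0 (- x))"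
  have "weak_conv_m E D" by (rule levy_continuity[OF E(1) D]) (simp add: E(3) lim)
  then have "(\<lambda>n. LINT x|E n. ?f x) \<longlonglongrightarrow> (LINT x|D. ?f x)"
    by (rule weak_conv_imp_integral_bdd_continuous_conv[OF E(1) D, where B=1])
       (auto intro!: continuous_intros)
  moreover have "(LINT x|E n. ?f x) = 0" for n
    by (rule integral_eq_zero_AE) (use E(2)[of n] in \<open>auto elim!: eventually_mono\<close>)
  ultimately have "(LINT x|D. ?f x) = 0" by (simp add: LIMSEQ_const_iff)
  then have "AE x in D. ?f x = 0"
    by (intro integral_nonneg_eq_0_AE D.integrable_const_bound[of _ 1]) auto
  then show ?thesis by eventually_elim (auto simp: min_def max_def split: if_splits)
qed

text \<open>Keep a nonnegative variable with probability \<open>p\<close>, independently of its value, and replace it by 0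
  otherwise.\<close>
lemma nonneg_char_mixture:
  assumes \<rho>: "nonneg_char \<rho>" and p: "0 \<le> p" "p \<le> 1"
  shows "nonneg_char (\<lambda>\<theta>. 1 + complex_of_real p * (\<rho> \<theta> - 1))"
proof -
  obtain D where D: "real_distribution D" "AE x in D. 0 \<le> x" "char D = \<rho>"
    using \<rho> unfolding nonneg_char_def by blast
  interpret D: real_distribution D by fact
  let ?b = "measure_pmf (bernoulli_pmf p)"
  interpret P: pair_prob_space ?b D ..
  let ?X = "\<lambda>z :: bool \<times> real. if fst z then snd z else 0"
  have m [measurable]: "?X \<in> borel_measurable (?b \<Otimes>\<^sub>M D)"
    by (rule borel_measurable_pair[OF sets_measure_pmf_count_space D.events_eq_borel]) measurable
  have "AE z in ?b \<Otimes>\<^sub>M D. 0 \<le> ?X z"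
  proof (rule P.AE_pair_measure)
    show "AE x in ?b. AE y in D. 0 \<le> ?X (x, y)"
      by (rule AE_I2) (use D(2) in \<open>auto elim!: eventually_mono\<close>)
  qed measurable
  then have "AE x in distr (?b \<Otimes>\<^sub>M D) borel ?X. 0 \<le> x" by (subst AE_distr_iff[OF m]) auto
  moreover have "char (distr (?b \<Otimes>\<^sub>M D) borel ?X) \<theta> = 1 + complex_of_real p * (\<rho> \<theta> - 1)" for \<theta>
  proof -
    have "char (distr (?b \<Otimes>\<^sub>M D) borel ?X) \<theta> = (CLINT z|?b \<Otimes>\<^sub>M D. iexp (\<theta> * ?X z))"
      unfolding char_def by (subst integral_distr[OF m]) auto
    also have "\<dots> = (CLINT b|?b. CLINT x|D. iexp (\<theta> * ?X (b, x)))"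
      by (rule P.integral_fst'[symmetric]) (intro P.integrable_const_bound[of _ 1], auto)
    also have "\<dots> = (\<Sum>b\<in>UNIV. pmf (bernoulli_pmf p) b *\<^sub>R (CLINT x|D. iexp (\<theta> * ?X (b, x))))"
      by (rule integral_measure_pmf) auto
    also have "\<dots> = p *\<^sub>R \<rho> \<theta> + (1 - p) *\<^sub>R 1"
      using p D.prob_space by (simp add: UNIV_bool D(3)[symmetric] char_def del: D.prob_space)
    finally show ?thesis by (simp add: algebra_simps scaleR_conv_of_real)
  qed
  moreover have "real_distribution (distr (?b \<Otimes>\<^sub>M D) borel ?X)"
    by (rule P.real_distribution_distr[OF m])
  ultimately show ?thesis unfolding nonneg_char_def by blast
qed

text \<open>Both \<open>1 + z/N\<close> and \<open>exp (z/N)\<close> have modulus at most 1, so their \<open>N\<close>-th powers differ by at most \<open>N\<close>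
  times the difference of the bases, which is of order \<open>1/N\<^sup>2\<close>.\<close>
lemma exp_limit_moving_base:
  fixes z :: "nat \<Rightarrow> complex" and N :: "nat \<Rightarrow> nat"
  assumes z: "z \<longlonglongrightarrow> w" and N: "filterlim N at_top sequentially"
    and le: "\<And>n. cmod (1 + z n / of_nat (N n)) \<le> 1" and Re: "\<And>n. Re (z n) \<le> 0"
  shows "(\<lambda>n. (1 + z n / of_nat (N n)) ^ N n) \<longlonglongrightarrow> exp w"
proof -
  have Nr: "filterlim (\<lambda>n. real (N n)) at_top sequentially"
    by (rule filterlim_compose[OF filterlim_real_sequentially N])
  have small: "(\<lambda>n. cmod (z n) / real (N n)) \<longlonglongrightarrow> 0"
    by (rule tendsto_divide_0[OF tendsto_norm[OF z] filterlim_at_top_imp_at_infinity[OF Nr]])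
  have "(\<lambda>n. 3 * cmod (z n) * (cmod (z n) / real (N n))) \<longlonglongrightarrow> 3 * cmod w * 0"
    by (intro tendsto_intros z small)
  then have err: "(\<lambda>n. 3 * cmod (z n) * (cmod (z n) / real (N n))) \<longlonglongrightarrow> 0" by simp
  have "eventually (\<lambda>n. cmod (z n) / real (N n) < 1) sequentially"
    by (rule order_tendstoD(2)[OF small]) simp
  moreover have "eventually (\<lambda>n. N n > 0) sequentially"
    using N unfolding filterlim_at_top by (auto elim!: allE[of _ 1] eventually_mono)
  ultimately have "eventually (\<lambda>n. cmod ((1 + z n / of_nat (N n)) ^ N n - exp (z n))
      \<le> 3 * cmod (z n) * (cmod (z n) / real (N n))) sequentially"
  proof eventually_elim
    case (elim n)
    define u where "u = z n / of_nat (N n)"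
    have u: "cmod u = cmod (z n) / real (N n)" unfolding u_def by (simp add: norm_divide)
    have zu: "z n = of_nat (N n) * u" using elim unfolding u_def by simp
    have "Re u \<le> 0" using Re[of n] elim unfolding u_def by (simp add: Re_divide_of_nat divide_nonpos_nonneg)
    then have eu: "cmod (exp u) \<le> 1" by simp
    have "cmod ((1 + u) ^ N n - exp (z n)) = cmod ((1 + u) ^ N n - exp u ^ N n)"
      unfolding zu by (simp add: exp_of_nat_mult)
    also have "\<dots> \<le> real (N n) * cmod ((1 + u) - exp u)"
      using le[of n] eu unfolding u_def[symmetric] by (rule norm_power_diff)
    also have "cmod ((1 + u) - exp u) \<le> exp (cmod u) * (cmod u)\<^sup>2"
      using Taylor_exp_field[of u 1] by (simp add: norm_minus_commute power2_eq_square)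
    also have "exp (cmod u) * (cmod u)\<^sup>2 \<le> 3 * (cmod u)\<^sup>2"
    proof (rule mult_right_mono)
      have "exp (cmod u) \<le> exp 1" using elim(1) u by simp
      then show "exp (cmod u) \<le> 3" using exp_le by (rule order_trans)
    qed simp
    finally have "cmod ((1 + u) ^ N n - exp (z n)) \<le> real (N n) * (3 * (cmod u)\<^sup>2)"
      by (simp add: mult_left_mono)
    also have "\<dots> = 3 * cmod (z n) * (cmod (z n) / real (N n))"
      using elim(2) unfolding u by (simp add: power2_eq_square)
    finally show ?case unfolding u_def .
  qed
  then have "(\<lambda>n. (1 + z n / of_nat (N n)) ^ N n - exp (z n)) \<longlonglongrightarrow> 0"
    by (rule Lim_null_comparison[OF _ err])
  from tendsto_add[OF this tendsto_exp[OF z]] show ?thesis by simp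
qed

text \<open>The law is the weak limit of sums of \<open>N n\<close> independent nonnegative variables, each of which is a jump
  larger than \<open>1/(n + 1)\<close> with the small probability that the Poisson intensity prescribes, and 0
  otherwise.\<close>
lemma levy_law_nonneg:
  assumes \<Lambda>: "subordinator_levy_measure \<Lambda>" and t: "0 \<le> t" and D: "real_distribution D"
    and ch: "\<And>\<theta>. char D \<theta> = exp (complex_of_real t * levy_exponent \<Lambda> \<theta>)"
  shows "AE x in D. 0 \<le> x"
proof -
  have meas\<Lambda>: "f \<in> borel_measurable borel \<Longrightarrow> f \<in> borel_measurable \<Lambda>" for f :: "real \<Rightarrow> 'b::topological_space"
    using measurable_cong_sets[OF sets_levy[OF \<Lambda>] refl] by blast
  define c where "c = (LINT v|\<Lambda>. min 1 \<bar>v\<bar>)"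
  have c: "0 \<le> c" unfolding c_def by (intro Bochner_Integration.integral_nonneg) auto
  \<comment> \<open>the intensity of jumps larger than \<open>1/(n + 1)\<close> is at most \<open>(n + 1) c\<close>, so \<open>(n + 1) K\<close> summands suffice
    to make the jump probability at most 1\<close>
  define K where "K = Suc (nat \<lceil>t * c\<rceil>)"
  have K: "t * c \<le> real K" unfolding K_def by linarith
  define A where "A n = {1 / real (Suc n)<..}" for n :: nat
  have [measurable]: "A n \<in> sets borel" for n unfolding A_def by auto
  define N where "N n = Suc n * K" for n
  have Npos: "0 < N n" for n unfolding N_def K_def by simp
  define l where "l n = measure \<Lambda> (A n)" for n
  have em: "emeasure \<Lambda> (A n) = ennreal (l n)" and l_bd: "0 \<le> l n" "l n \<le> real (Suc n) * c" for n
  proof -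
    have le: "emeasure \<Lambda> (A n) \<le> ennreal (real (Suc n) * c)"
      using levy_tail_le[OF \<Lambda>, of "1 / real (Suc n)"] unfolding A_def c_def by (simp add: mult.commute)
    then have "emeasure \<Lambda> (A n) \<noteq> \<infinity>" by (auto simp: top_unique)
    then show em: "emeasure \<Lambda> (A n) = ennreal (l n)"
      unfolding l_def by (simp add: emeasure_eq_ennreal_measure)
    show "0 \<le> l n" unfolding l_def by simp
    show "l n \<le> real (Suc n) * c"
      using le c unfolding em by (subst (asm) ennreal_le_iff) (auto intro!: mult_nonneg_nonneg)
  qed
  define z where "z n \<theta> = complex_of_real t * (CLINT v|\<Lambda>. indicator (A n) v *\<^sub>R (iexp (\<theta> * v) - 1))" for n \<theta>
  have int: "integrable \<Lambda> (\<lambda>v. indicator (A n) v *\<^sub>R (iexp (\<theta> * v) - 1))" for n \<theta>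
    by (rule integrable_mult_indicator) (use integrable_iexp_minus_1_levy[OF \<Lambda>] in \<open>auto simp: sets_levy[OF \<Lambda>]\<close>)
  have factor: "nonneg_char (\<lambda>\<theta>. 1 + z n \<theta> / of_nat (N n))" for n
  proof (cases "l n = 0")
    case True
    have "AE v in \<Lambda>. v \<notin> A n"
      by (rule AE_I'[of "A n"]) (use em True in \<open>auto simp: null_sets_def sets_levy[OF \<Lambda>]\<close>)
    then have "(CLINT v|\<Lambda>. indicator (A n) v *\<^sub>R (iexp (\<theta> * v) - 1)) = 0" for \<theta>
      by (intro integral_eq_zero_AE) (auto elim!: eventually_mono)
    then show ?thesis unfolding z_def using nonneg_char_1 by simp
  next
    case False
    then have lpos: "0 < l n" using l_bd(1)[of n] by simp
    have dm [measurable]: "(\<lambda>v. ennreal (indicator (A n) v / l n)) \<in> borel_measurable \<Lambda>"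
      by (rule meas\<Lambda>) measurable
    define \<rho> where "\<rho> = density \<Lambda> (\<lambda>v. ennreal (indicator (A n) v / l n))"
    have "emeasure \<rho> (space \<rho>) = (\<integral>\<^sup>+v. ennreal (1 / l n) * indicator (A n) v \<partial>\<Lambda>)"
      unfolding \<rho>_def by (subst emeasure_density) (auto intro!: nn_integral_cong split: split_indicator)
    also have "\<dots> = ennreal (1 / l n) * ennreal (l n)"
      unfolding em[symmetric] by (subst nn_integral_cmult_indicator) (auto simp: sets_levy[OF \<Lambda>])
    also have "\<dots> = 1" using lpos by (simp flip: ennreal_mult')
    finally interpret \<rho>: prob_space \<rho> by (rule prob_spaceI)
    interpret \<rho>: real_distribution \<rho> by standard (simp add: \<rho>_def sets_levy[OF \<Lambda>])
    have AE\<rho>: "AE v in \<rho>. 0 \<le> v"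
      unfolding \<rho>_def AE_density[OF dm]
      using AE_levy_pos[OF \<Lambda>] by eventually_elim simp
    have "nonneg_char (char \<rho>)" unfolding nonneg_char_def using \<rho>.real_distribution_axioms AE\<rho> by blast
    moreover have "0 \<le> t * l n / real (N n)" using t l_bd(1) by simp
    moreover have "t * l n / real (N n) \<le> 1"
    proof -
      have "t * l n \<le> t * (real (Suc n) * c)" using l_bd(2) t by (rule mult_left_mono)
      also have "\<dots> = real (Suc n) * (t * c)" by simp
      also have "\<dots> \<le> real (Suc n) * real K" using K by (rule mult_left_mono) simp
      also have "\<dots> = real (N n)" unfolding N_def by (rule of_nat_mult[symmetric])
      finally show ?thesis using Npos[of n] by simp
    qed
    ultimately have "nonneg_char (\<lambda>\<theta>. 1 + complex_of_real (t * l n / real (N n)) * (char \<rho> \<theta> - 1))"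
      by (rule nonneg_char_mixture)
    moreover have "complex_of_real (t * l n / real (N n)) * (char \<rho> \<theta> - 1) = z n \<theta> / of_nat (N n)" for \<theta>
    proof -
      have "char \<rho> \<theta> - 1 = (CLINT v|\<rho>. iexp (\<theta> * v) - 1)"
        unfolding char_def using \<rho>.prob_space
        by (subst Bochner_Integration.integral_diff) (auto intro!: \<rho>.integrable_const_bound[of _ 1])
      also have "\<dots> = (CLINT v|\<Lambda>. (indicator (A n) v / l n) *\<^sub>R (iexp (\<theta> * v) - 1))"
        unfolding \<rho>_def using lpos by (subst integral_density) (auto intro!: meas\<Lambda>)
      also have "\<dots> = (CLINT v|\<Lambda>. (1 / l n) *\<^sub>R (indicator (A n) v *\<^sub>R (iexp (\<theta> * v) - 1)))"
        by (intro Bochner_Integration.integral_cong) (auto split: split_indicator)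
      also have "\<dots> = (1 / l n) *\<^sub>R (CLINT v|\<Lambda>. indicator (A n) v *\<^sub>R (iexp (\<theta> * v) - 1))"
        by (rule integral_scaleR_right)
      finally show ?thesis unfolding z_def using lpos by (simp add: scaleR_conv_of_real)
    qed
    ultimately show ?thesis by (simp only:)
  qed
  show ?thesis
  proof (rule nonneg_char_limit[OF D nonneg_char_power[OF factor]])
    fix \<theta>
    show "(\<lambda>n. (1 + z n \<theta> / of_nat (N n)) ^ N n) \<longlonglongrightarrow> char D \<theta>"
      unfolding ch
    proof (rule exp_limit_moving_base)
      show "(\<lambda>n. z n \<theta>) \<longlonglongrightarrow> complex_of_real t * levy_exponent \<Lambda> \<theta>"
        unfolding z_def levy_exponent_def
      proof (intro tendsto_mult tendsto_const integral_dominated_convergence[where w="\<lambda>v. cmod (iexp (\<theta> * v) - 1)"])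
        show "AE v in \<Lambda>. (\<lambda>n. indicator (A n) v *\<^sub>R (iexp (\<theta> * v) - 1)) \<longlonglongrightarrow> iexp (\<theta> * v) - 1"
          using AE_levy_pos[OF \<Lambda>]
        proof eventually_elim
          case (elim v)
          have "(\<lambda>n. 1 / real (Suc n)) \<longlonglongrightarrow> 0" by real_asymp
          then have "eventually (\<lambda>n. 1 / real (Suc n) < v) sequentially"
            using elim by (rule order_tendstoD(2))
          then show ?case
            by (intro tendsto_eventually) (auto elim!: eventually_mono simp: A_def)
        qed
        show "integrable \<Lambda> (\<lambda>v. cmod (iexp (\<theta> * v) - 1))"
          by (intro integrable_norm integrable_iexp_minus_1_levy[OF \<Lambda>])
        show "AE v in \<Lambda>. norm (indicator (A n) v *\<^sub>R (iexp (\<theta> * v) - 1)) \<le> cmod (iexp (\<theta> * v) - 1)" for n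
          by (intro AE_I2) (auto split: split_indicator)
        show "(\<lambda>v. iexp (\<theta> * v) - 1) \<in> borel_measurable \<Lambda>"
          by (rule meas\<Lambda>) measurable
        show "(\<lambda>v. indicator (A n) v *\<^sub>R (iexp (\<theta> * v) - 1)) \<in> borel_measurable \<Lambda>" for n
          by (rule meas\<Lambda>) measurable
      qed
      show "filterlim N at_top sequentially"
        by (rule filterlim_at_top_mono[OF filterlim_Suc]) (simp add: N_def K_def)
      show "cmod (1 + z n \<theta> / of_nat (N n)) \<le> 1" for n by (rule norm_nonneg_char_le_1[OF factor])
      show "Re (z n \<theta>) \<le> 0" for n
      proof -
        have "Re (z n \<theta>) = t * (LINT v|\<Lambda>. Re (indicator (A n) v *\<^sub>R (iexp (\<theta> * v) - 1)))"
          unfolding z_def by (simp only: integral_Re[OF int] Re_complex_of_real Im_complex_of_real times_complex.sel)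
        moreover have "(LINT v|\<Lambda>. Re (indicator (A n) v *\<^sub>R (iexp (\<theta> * v) - 1))) \<le> 0"
        proof -
          have "0 \<le> (LINT v|\<Lambda>. - Re (indicator (A n) v *\<^sub>R (iexp (\<theta> * v) - 1)))"
            by (intro Bochner_Integration.integral_nonneg) (auto simp: Re_exp split: split_indicator)
          then show ?thesis by simp
        qed
        ultimately show ?thesis using t by (simp add: mult_nonneg_nonpos)
      qed
    qed
  qed
qed

section \<open>Continuous ratio limits make the median a centered norming\<close>
lemma tight_if_eventually_tight:
  assumes \<mu>: "\<And>n. real_distribution (\<mu> n)"
    and ev: "\<And>\<epsilon>. \<epsilon> > 0 \<Longrightarrow> \<exists>K. eventually (\<lambda>n. measure (\<mu> n) {x. \<bar>x\<bar> > K} < \<epsilon>) sequentially"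
  shows "tight \<mu>"
  unfolding tight_def
proof (intro conjI allI impI \<mu>)
  fix \<epsilon> :: real assume \<epsilon>: "0 < \<epsilon>"
  obtain K N where K: "\<And>n. n \<ge> N \<Longrightarrow> measure (\<mu> n) {x. \<bar>x\<bar> > K} < \<epsilon>"
    using ev[OF \<epsilon>] by (auto simp: eventually_sequentially)
  have "\<exists>K. measure (\<mu> n) {x. \<bar>x\<bar> > K} < \<epsilon>" for n
    using weak_conv_m_imp_eventually_tight[of "\<lambda>_. \<mu> n" "\<mu> n" \<epsilon>] \<mu> \<epsilon>
    by (auto simp: weak_conv_m_def weak_conv_def)
  then obtain L where L: "\<And>n. measure (\<mu> n) {x. \<bar>x\<bar> > L n} < \<epsilon>" by metis
  define C where "C = Max (insert \<bar>K\<bar> ((\<lambda>n. \<bar>L n\<bar>) ` {..<N}))"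
  have CK: "K \<le> C" unfolding C_def by (rule order_trans[OF abs_ge_self Max_ge]) auto
  have C0: "0 \<le> C" unfolding C_def by (rule order_trans[OF abs_ge_zero Max_ge[of _ "\<bar>K\<bar>"]]) auto
  have CL: "L n \<le> C" if "n < N" for n
    unfolding C_def using that by (intro order_trans[OF abs_ge_self Max_ge]) auto
  have "1 - \<epsilon> < measure (\<mu> n) {- (C + 1)<..C + 1}" for n
  proof -
    interpret real_distribution "\<mu> n" by (rule \<mu>)
    obtain K' where K': "K' \<le> C" "prob {x. \<bar>x\<bar> > K'} < \<epsilon>"
      using K[of n] L[of n] CK CL[of n] by (cases "n < N") auto
    have "1 - prob {- (C + 1)<..C + 1} = prob (UNIV - {- (C + 1)<..C + 1})"
      using prob_compl[of "{- (C + 1)<..C + 1}"] by simp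
    also have "\<dots> \<le> prob {x. \<bar>x\<bar> > K'}"
      using K'(1) by (intro finite_measure_mono) auto
    finally show ?thesis using K'(2) by simp
  qed
  then show "\<exists>a b. a < b \<and> (\<forall>n. 1 - \<epsilon> < measure (\<mu> n) {a<..b})"
    using C0 by (intro exI[of _ "- (C + 1)"] exI[of _ "C + 1"]) auto
qed

lemma real_distribution_median:
  assumes D: "real_distribution D"
  obtains m where "1 / 2 \<le> measure D {..m}" "1 / 2 \<le> measure D {m..}"
proof -
  interpret real_distribution D by fact
  define S where "S = {x. 1 / 2 \<le> cdf D x}"
  have "eventually (\<lambda>x. 1 / 2 < cdf D x) at_top"
    by (rule order_tendstoD(1)[OF cdf_lim_at_top_prob]) simp
  then obtain x1 where "1 / 2 < cdf D x1" using eventually_happens[of _ "at_top :: real filter"] by auto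
  then have ne: "S \<noteq> {}" unfolding S_def by (auto intro: less_imp_le)
  have "eventually (\<lambda>x. cdf D x < 1 / 2) at_bot"
    by (rule order_tendstoD(2)[OF cdf_lim_at_bot]) simp
  then obtain x0 where x0: "cdf D x0 < 1 / 2" using eventually_happens[of _ "at_bot :: real filter"] by auto
  have bdd: "bdd_below S"
  proof (rule bdd_belowI[of _ x0])
    fix x assume "x \<in> S"
    then have "cdf D x0 < cdf D x" using x0 unfolding S_def by simp
    then show "x0 \<le> x" using cdf_nondecreasing[of x x0] by (meson linear not_less)
  qed
  define m where "m = Inf S"
  have below: "cdf D x \<le> 1 / 2" if "x < m" for x
    using cInf_lower[OF _ bdd, of x] that unfolding m_def S_def by force
  have above: "1 / 2 \<le> cdf D x" if x: "x > m" for x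
  proof -
    obtain y where "y \<in> S" "y < x" using cInf_lessD[OF ne, of x] x unfolding m_def by auto
    then show ?thesis using cdf_nondecreasing[of y x] unfolding S_def by simp
  qed
  have "1 / 2 \<le> cdf D m"
    using cdf_is_right_cont[of m] unfolding continuous_within
  proof (rule tendsto_lowerbound)
    show "eventually (\<lambda>x. 1 / 2 \<le> cdf D x) (at_right m)"
      by (rule eventually_mono[OF eventually_at_right_less above])
  qed simp
  moreover have "measure D {..<m} \<le> 1 / 2"
  proof (rule tendsto_upperbound[OF cdf_at_left])
    show "eventually (\<lambda>x. cdf D x \<le> 1 / 2) (at_left m)"
      using below by (auto simp: eventually_at_left_field simp del: le_divide_eq_numeral1 intro!: exI[of _ "m - 1"])
  qed simp
  moreover have "measure D {m..} = 1 - measure D {..<m}"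
    using prob_compl[of "{..<m}"] by (simp add: Compl_eq_Diff_UNIV[symmetric] Compl_lessThan)
  ultimately show thesis using that[of m] by (simp add: cdf_def)
qed

definition fair_coin :: "real measure" where
  "fair_coin = distr (measure_pmf (bernoulli_pmf (1 / 2))) borel of_bool"

lemma integral_fair_coin:
  fixes f :: "real \<Rightarrow> 'b::{banach, second_countable_topology}"
  assumes [measurable]: "f \<in> borel_measurable borel"
  shows "(LINT x|fair_coin. f x) = (1 / 2) *\<^sub>R f 0 + (1 / 2) *\<^sub>R f 1"
proof -
  have "(LINT x|fair_coin. f x) = (LINT b|measure_pmf (bernoulli_pmf (1 / 2)). f (of_bool b))"
    unfolding fair_coin_def by (subst integral_distr) auto
  also have "\<dots> = (\<Sum>b\<in>UNIV. pmf (bernoulli_pmf (1 / 2)) b *\<^sub>R f (of_bool b))"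
    by (rule integral_measure_pmf) auto
  finally show ?thesis by (simp add: UNIV_bool add.commute)
qed

lemma fair_coin_in_class_X: "fair_coin \<in> class_X"
proof -
  have d: "real_distribution fair_coin"
    unfolding fair_coin_def by (rule prob_space.real_distribution_distr[OF measure_pmf.prob_space_axioms]) simp
  interpret real_distribution fair_coin by fact
  have "integrable fair_coin (\<lambda>x. x)"
    unfolding fair_coin_def by (subst integrable_distr_eq) (auto intro!: integrable_measure_pmf_finite)
  moreover have "measure fair_coin {c} \<noteq> 1" for c
  proof -
    have "measure fair_coin {c} = (LINT x|fair_coin. indicator {c} x :: real)" by simp
    also have "\<dots> = (1 / 2) * indicator {c} 0 + (1 / 2) * indicator {c} 1"
      by (subst integral_fair_coin) auto
    finally show ?thesis by (auto split: split_indicator)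
  qed
  ultimately show ?thesis
    using d by (auto simp: class_X_def finite_mean_distribution_def nondegenerate_def)
qed

text \<open>Thinning the jumps with a fair coin splits \<open>V\<^sub>2\<^sub>t\<close> into the parts \<open>U\<^sub>2\<^sub>t\<close> and \<open>V\<^sub>2\<^sub>t - U\<^sub>2\<^sub>t\<close>. Each of their linear
  combinations has the law of the same combination of two independent variables with law \<open>D\<close>, which is
  all that is needed since \<open>U/V \<le> c\<close> means \<open>(1 - c) U \<le> c (V - U)\<close>.\<close>
lemma fair_coin_ratio:
  assumes \<Lambda>: "subordinator_levy_measure \<Lambda>" and UV: "randomly_weighted_pair \<Lambda> fair_coin M U V"
    and t: "0 \<le> t" and D: "real_distribution D"
    and ch: "\<And>\<theta>. char D \<theta> = exp (complex_of_real t * levy_exponent \<Lambda> \<theta>)"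
  shows "AE \<omega> in M. 0 \<le> U (2 * t) \<omega> / V (2 * t) \<omega> \<and> U (2 * t) \<omega> / V (2 * t) \<omega> \<le> 1"
    and "0 \<le> c \<Longrightarrow> measure M {\<omega> \<in> space M. U (2 * t) \<omega> / V (2 * t) \<omega> \<le> c}
      = measure (D \<Otimes>\<^sub>M D) {z. (1 - c) * fst z \<le> c * snd z}"
proof -
  have F: "finite_mean_distribution fair_coin" using fair_coin_in_class_X by (simp add: class_X_def)
  have t2: "0 \<le> 2 * t" using t by simp
  interpret M: prob_space M by (rule randomly_weighted_pair_measurable(1)[OF \<Lambda> UV t2])
  note [measurable] = randomly_weighted_pair_measurable(2,3)[OF \<Lambda> UV t2] levy_exponent_measurable[OF \<Lambda>]
  interpret D: real_distribution D by fact
  interpret P: pair_prob_space D D ..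
  let ?L = "\<lambda>\<alpha> \<beta>. distr M borel (\<lambda>\<omega>. (\<alpha> - \<beta>) * U (2 * t) \<omega> + \<beta> * V (2 * t) \<omega>)"
  have Ld: "real_distribution (?L \<alpha> \<beta>)" for \<alpha> \<beta> by (intro M.real_distribution_distr) measurable
  have chL: "char (?L \<alpha> \<beta>) \<theta> = char D (\<alpha> * \<theta>) * char D (\<beta> * \<theta>)" for \<alpha> \<beta> \<theta>
  proof -
    have "char (?L \<alpha> \<beta>) \<theta> = exp (complex_of_real (2 * t) *
        (CLINT x|fair_coin. levy_exponent \<Lambda> (\<theta> * ((\<alpha> - \<beta>) * x + \<beta>))))"
      by (rule char_linear_combination[OF \<Lambda> UV F t2])
    also have "(CLINT x|fair_coin. levy_exponent \<Lambda> (\<theta> * ((\<alpha> - \<beta>) * x + \<beta>)))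
        = (1 / 2) *\<^sub>R levy_exponent \<Lambda> (\<theta> * \<beta>) + (1 / 2) *\<^sub>R levy_exponent \<Lambda> (\<theta> * \<alpha>)"
      by (subst integral_fair_coin) (auto simp: algebra_simps)
    finally show ?thesis
      by (simp add: ch scaleR_conv_of_real ring_distribs mult.commute add.commute flip: exp_add)
  qed
  have law: "?L \<alpha> \<beta> = distr (D \<Otimes>\<^sub>M D) borel (\<lambda>z. \<alpha> * fst z + \<beta> * snd z)" for \<alpha> \<beta>
    by (rule Levy_uniqueness[OF Ld real_distribution_pair_linear[OF D D]])
       (auto simp: chL char_pair_linear[OF D D])
  have D0: "char D 0 = 1" by (rule D.char_zero)
  have D_nonneg: "AE x in D. 0 \<le> x" by (rule levy_law_nonneg[OF \<Lambda> t D ch])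
  have LD: "?L 1 0 = D" "?L 0 1 = D"
    by (rule Levy_uniqueness[OF Ld D], rule ext, simp only: chL, simp add: D0)+
  have U_nonneg: "AE \<omega> in M. 0 \<le> U (2 * t) \<omega>"
    using D_nonneg unfolding LD(1)[symmetric] by (subst (asm) AE_distr_iff) auto
  have VU: "AE \<omega> in M. U (2 * t) \<omega> \<le> V (2 * t) \<omega>"
    using D_nonneg unfolding LD(2)[symmetric] by (subst (asm) AE_distr_iff) auto
  show "AE \<omega> in M. 0 \<le> U (2 * t) \<omega> / V (2 * t) \<omega> \<and> U (2 * t) \<omega> / V (2 * t) \<omega> \<le> 1"
    using U_nonneg VU by eventually_elim (auto simp: divide_le_eq)
  assume c: "0 \<le> c"
  have "measure M {\<omega> \<in> space M. U (2 * t) \<omega> / V (2 * t) \<omega> \<le> c}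
      = measure M {\<omega> \<in> space M. ((1 - c) - (- c)) * U (2 * t) \<omega> + (- c) * V (2 * t) \<omega> \<le> 0}"
  proof (rule M.finite_measure_eq_AE)
    show "AE \<omega> in M. (\<omega> \<in> {\<omega> \<in> space M. U (2 * t) \<omega> / V (2 * t) \<omega> \<le> c}) =
        (\<omega> \<in> {\<omega> \<in> space M. ((1 - c) - (- c)) * U (2 * t) \<omega> + (- c) * V (2 * t) \<omega> \<le> 0})"
      using U_nonneg VU
    proof eventually_elim
      case (elim \<omega>)
      then show ?case using c by (cases "V (2 * t) \<omega> = 0") (auto simp: divide_le_eq)
    qed
  qed measurable
  also have "\<dots> = measure (?L (1 - c) (- c)) {..0}"
    by (subst measure_distr) (auto simp: vimage_def Int_def conj_commute)
  also have "\<dots> = measure (distr (D \<Otimes>\<^sub>M D) borel (\<lambda>z. (1 - c) * fst z + (- c) * snd z)) {..0}"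
    unfolding law ..
  also have "\<dots> = measure (D \<Otimes>\<^sub>M D) {z. (1 - c) * fst z \<le> c * snd z}"
    by (subst measure_distr) (auto simp: vimage_def space_pair_measure intro!: borel_measurable_pair[of D borel D borel])
  finally show "measure M {\<omega> \<in> space M. U (2 * t) \<omega> / V (2 * t) \<omega> \<le> c}
      = measure (D \<Otimes>\<^sub>M D) {z. (1 - c) * fst z \<le> c * snd z}" .
qed

lemma pair_halfplane_bounds:
  assumes D: "real_distribution D" and X: "X \<in> sets borel" and Y: "Y \<in> sets borel"
  shows "(\<And>x y. x \<in> X \<Longrightarrow> y \<in> Y \<Longrightarrow> a * x \<le> b * y) \<Longrightarrow>
      measure D X * measure D Y \<le> measure (D \<Otimes>\<^sub>M D) {z. a * fst z \<le> b * snd z}"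
    and "(\<And>x y. x \<in> X \<Longrightarrow> y \<in> Y \<Longrightarrow> \<not> a * x \<le> b * y) \<Longrightarrow>
      measure (D \<Otimes>\<^sub>M D) {z. a * fst z \<le> b * snd z} \<le> 1 - measure D X * measure D Y"
proof -
  interpret D: real_distribution D by fact
  interpret P: pair_prob_space D D ..
  let ?H = "{z :: real \<times> real. a * fst z \<le> b * snd z}"
  have sp: "space (D \<Otimes>\<^sub>M D) = UNIV" by (simp add: space_pair_measure)
  have sets: "sets (D \<Otimes>\<^sub>M D) = sets (borel \<Otimes>\<^sub>M borel)"
    by (intro sets_pair_measure_cong D.events_eq_borel)
  have H: "?H \<in> sets (D \<Otimes>\<^sub>M D)"
  proof -
    have "{z \<in> space (borel \<Otimes>\<^sub>M borel). a * fst z \<le> b * snd z} \<in> sets (borel \<Otimes>\<^sub>M borel)" by measurable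
    then show ?thesis unfolding sets by (simp add: space_pair_measure)
  qed
  have XY: "X \<times> Y \<in> sets (D \<Otimes>\<^sub>M D)" using X Y unfolding sets by (rule pair_measureI)
  have prod: "measure (D \<Otimes>\<^sub>M D) (X \<times> Y) = measure D X * measure D Y"
    using X Y by (simp add: measure_def D.emeasure_pair_measure_Times enn2real_mult)
  show "measure D X * measure D Y \<le> measure (D \<Otimes>\<^sub>M D) ?H"
    if "\<And>x y. x \<in> X \<Longrightarrow> y \<in> Y \<Longrightarrow> a * x \<le> b * y"
    unfolding prod[symmetric] using that H by (intro P.finite_measure_mono) auto
  show "measure (D \<Otimes>\<^sub>M D) ?H \<le> 1 - measure D X * measure D Y"
    if "\<And>x y. x \<in> X \<Longrightarrow> y \<in> Y \<Longrightarrow> \<not> a * x \<le> b * y"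
  proof -
    have "measure (D \<Otimes>\<^sub>M D) ?H \<le> measure (D \<Otimes>\<^sub>M D) (space (D \<Otimes>\<^sub>M D) - X \<times> Y)"
      using that sp sets.compl_sets[OF XY] by (intro P.finite_measure_mono) auto
    also have "\<dots> = 1 - measure D X * measure D Y" using P.prob_compl[OF XY] prod by simp
    finally show ?thesis .
  qed
qed

text \<open>Write the ratio as \<open>R / (R + S)\<close> and norm by the median. The median is eventually positive, for
  otherwise the ratio would vanish with probability at least 1/2. Since \<open>R\<close> is at most the median with
  probability at least 1/2, a heavy tail of \<open>S\<close> would put mass near ratio 0, so continuity at 0 forces
  tightness. A degenerate limit \<open>w\<close> must satisfy \<open>w \<ge> 1\<close> by the choice of the median, and then the
  ratio would concentrate at 1/2.\<close>
theorem compact_norming_if_ratio_limits_continuous: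
  assumes G: "G = at_right 0 \<or> G = at_top"
    and \<Lambda>: "subordinator_levy_measure \<Lambda>" and UV: "randomly_weighted_pair \<Lambda> fair_coin M U V"
    and cont: "\<And>\<mu>. subsequential_ratio_limit G M U V \<mu> \<Longrightarrow> continuous_distribution \<mu>"
    and \<nu>: "\<And>t. t > 0 \<Longrightarrow> real_distribution (\<nu> t)"
    and ch: "\<And>t \<theta>. t > 0 \<Longrightarrow> char (\<nu> t) \<theta> = exp (complex_of_real t * levy_exponent \<Lambda> \<theta>)"
  shows "\<exists>B. compact_norming G \<nu> B"
proof -
  have "\<exists>m. 1 / 2 \<le> measure (\<nu> t) {..m} \<and> 1 / 2 \<le> measure (\<nu> t) {m..}" if "t > 0" for t
    using real_distribution_median[OF \<nu>[OF that]] by blast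
  then obtain m where m: "\<And>t. t > 0 \<Longrightarrow> 1 / 2 \<le> measure (\<nu> t) {..m t}"
    "\<And>t. t > 0 \<Longrightarrow> 1 / 2 \<le> measure (\<nu> t) {m t..}" by metis
  \<comment> \<open>the value 1 only serves to keep the norming positive at the times with median 0\<close>
  define B where "B t = (if m t > 0 then m t else 1)" for t
  have "compact_norming G \<nu> B"
    unfolding compact_norming_def
  proof (intro conjI allI impI)
    show "0 < B t" for t unfolding B_def by simp
    fix t assume t: "time_sequence G t"
    have tpos: "0 < t k" for k using t by (simp add: time_sequence_def)
    interpret M: prob_space M by (rule randomly_weighted_pair_measurable(1)[OF \<Lambda> UV order_refl])
    have meas [measurable]: "U (2 * t k) \<in> borel_measurable M" "V (2 * t k) \<in> borel_measurable M" for k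
      using randomly_weighted_pair_measurable(2,3)[OF \<Lambda> UV, of "2 * t k"] tpos[of k] by auto
    define Z where "Z k = distr M borel (\<lambda>\<omega>. U (2 * t k) \<omega> / V (2 * t k) \<omega>)" for k
    have Zd: "real_distribution (Z k)" for k unfolding Z_def by (intro M.real_distribution_distr) measurable
    note ratio = fair_coin_ratio[OF \<Lambda> UV less_imp_le[OF tpos] \<nu>[OF tpos] ch[OF tpos]]
    have cdfZ: "cdf (Z k) c = measure M {\<omega> \<in> space M. U (2 * t k) \<omega> / V (2 * t k) \<omega> \<le> c}" for k c
      unfolding cdf_def Z_def by (subst measure_distr) (auto simp: vimage_def Int_def conj_commute)
    have cdfZ_neg: "cdf (Z k) c = 0" if "c < 0" for k c
    proof -
      have "AE \<omega> in M. \<not> U (2 * t k) \<omega> / V (2 * t k) \<omega> \<le> c"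
        using ratio(1)[of k] by eventually_elim (use that in auto)
      then show ?thesis unfolding cdfZ by (subst M.prob_eq_0) auto
    qed
    have "tight Z"
      unfolding tight_def
    proof (intro conjI allI impI Zd)
      fix \<epsilon> :: real assume \<epsilon>: "0 < \<epsilon>"
      have "measure (Z k) {-1<..1} = 1" for k
      proof -
        have "measure (Z k) {-1<..1} = measure M {\<omega> \<in> space M. U (2 * t k) \<omega> / V (2 * t k) \<omega> \<in> {-1<..1}}"
          unfolding Z_def by (subst measure_distr) (auto simp: vimage_def Int_def conj_commute)
        also have "\<dots> = 1"
        proof (subst M.prob_eq_1)
          show "AE \<omega> in M. \<omega> \<in> {\<omega> \<in> space M. U (2 * t k) \<omega> / V (2 * t k) \<omega> \<in> {-1<..1}}"
            using ratio(1)[of k] AE_space by eventually_elim auto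
        qed measurable
        finally show ?thesis .
      qed
      then show "\<exists>a b. a < b \<and> (\<forall>n. 1 - \<epsilon> < measure (Z n) {a<..b})"
        using \<epsilon> by (intro exI[of _ "-1"] exI[of _ 1]) auto
    qed
    then obtain r \<mu> where r: "strict_mono (r :: nat \<Rightarrow> nat)" and \<mu>: "real_distribution \<mu>"
      and "weak_conv_m (Z \<circ> id \<circ> r) \<mu>"
      using tight_imp_convergent_subsubsequence[of Z id] by (auto simp: strict_mono_def)
    then have conv: "weak_conv_m (\<lambda>k. Z (r k)) \<mu>" by (simp add: comp_def)
    interpret \<mu>: real_distribution \<mu> by fact
    have "subsequential_ratio_limit G M U V \<mu>"
      unfolding subsequential_ratio_limit_def
      using \<mu> conv time_sequence_subseq[OF time_sequence_scale[OF G t, of 2] r] unfolding Z_def by auto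
    then have "continuous_distribution \<mu>" by (rule cont)
    then have isC: "isCont (cdf \<mu>) c" for c
      unfolding continuous_distribution_def by (simp add: continuous_on_eq_continuous_at)
    have lim: "(\<lambda>k. cdf (Z (r k)) c) \<longlonglongrightarrow> cdf \<mu> c" for c
      using conv isC unfolding weak_conv_m_def weak_conv_def by blast
    have neg: "cdf \<mu> c = 0" if "c < 0" for c
      using lim[of c] cdfZ_neg[OF that] by (simp add: LIMSEQ_const_iff)
    have cdf0: "cdf \<mu> 0 = 0"
    proof -
      have "(cdf \<mu> \<longlongrightarrow> cdf \<mu> 0) (at_left 0)"
        using isC[of 0] unfolding isCont_def by (rule tendsto_within_subset) simp
      moreover have "(cdf \<mu> \<longlongrightarrow> 0) (at_left 0)"
        by (rule tendsto_eventually) (auto simp: eventually_at_left_field neg intro!: exI[of _ "-1"])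
      ultimately show ?thesis using tendsto_unique[of "at_left (0::real)"] by simp
    qed
    define \<tau> where "\<tau> k = t (r k)" for k
    have \<tau>: "0 < \<tau> k" for k unfolding \<tau>_def by (rule tpos)
    have lower: "measure (\<nu> (\<tau> k)) X * measure (\<nu> (\<tau> k)) Y \<le> cdf (Z (r k)) c"
      if "0 \<le> c" "X \<in> sets borel" "Y \<in> sets borel" "\<And>x y. x \<in> X \<Longrightarrow> y \<in> Y \<Longrightarrow> (1 - c) * x \<le> c * y" for k c X Y
      unfolding cdfZ ratio(2)[OF that(1)] \<tau>_def by (rule pair_halfplane_bounds(1)[OF \<nu>[OF tpos] that(2-4)])
    have upper: "cdf (Z (r k)) c \<le> 1 - measure (\<nu> (\<tau> k)) X * measure (\<nu> (\<tau> k)) Y"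
      if "0 \<le> c" "X \<in> sets borel" "Y \<in> sets borel" "\<And>x y. x \<in> X \<Longrightarrow> y \<in> Y \<Longrightarrow> \<not> (1 - c) * x \<le> c * y" for k c X Y
      unfolding cdfZ ratio(2)[OF that(1)] \<tau>_def by (rule pair_halfplane_bounds(2)[OF \<nu>[OF tpos] that(2-4)])
    have m_pos: "eventually (\<lambda>k. 0 < m (\<tau> k)) sequentially"
    proof -
      have "eventually (\<lambda>k. cdf (Z (r k)) 0 < 1 / 2) sequentially"
        by (rule order_tendstoD(2)[OF lim]) (simp add: cdf0)
      then show ?thesis
      proof eventually_elim
        case (elim k)
        interpret D: real_distribution "\<nu> (\<tau> k)" by (rule \<nu>[OF \<tau>])
        have "measure (\<nu> (\<tau> k)) {..0} * measure (\<nu> (\<tau> k)) UNIV \<le> cdf (Z (r k)) 0"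
          by (rule lower) auto
        then have "measure (\<nu> (\<tau> k)) {..0} < 1 / 2" using elim D.prob_space by simp
        moreover have "measure (\<nu> (\<tau> k)) {..m (\<tau> k)} \<le> measure (\<nu> (\<tau> k)) {..0}" if "m (\<tau> k) \<le> 0"
          using that by (intro D.finite_measure_mono) auto
        ultimately show ?case using m(1)[OF \<tau>, of k] by fastforce
      qed
    qed
    define X where "X k = rescale (B (\<tau> k)) (\<nu> (\<tau> k))" for k
    have Xd: "real_distribution (X k)" for k unfolding X_def by (intro real_distribution_rescale \<nu> \<tau>)
    have Bpos: "0 < B s" for s unfolding B_def by simp
    have X_set: "measure (X k) A = measure (\<nu> (\<tau> k)) {x. x / B (\<tau> k) \<in> A}" if "A \<in> sets borel" for k A
      unfolding X_def by (rule measure_rescale[OF \<nu>[OF \<tau>] that])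
    have neg_X: "measure (X k) {..<0} = 0" for k
    proof -
      have "AE x in \<nu> (\<tau> k). 0 \<le> x" by (rule levy_law_nonneg[OF \<Lambda> less_imp_le[OF \<tau>] \<nu>[OF \<tau>] ch[OF \<tau>]])
      then have "AE x in \<nu> (\<tau> k). x \<notin> {x. x / B (\<tau> k) \<in> {..<0}}"
        by eventually_elim (use Bpos[of "\<tau> k"] in \<open>auto simp: divide_less_0_iff\<close>)
      moreover interpret D: real_distribution "\<nu> (\<tau> k)" by (rule \<nu>[OF \<tau>])
      have "{x. x / B (\<tau> k) \<in> {..<0}} \<in> sets borel" by measurable
      ultimately show ?thesis unfolding X_set[OF borel_open[OF open_lessThan]] by (subst D.prob_eq_0) auto
    qed
    have lowerX: "measure (X k) S * measure (X k) T \<le> cdf (Z (r k)) c"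
      if "0 \<le> c" and [measurable]: "S \<in> sets borel" "T \<in> sets borel"
        and ST: "\<And>x y. x \<in> S \<Longrightarrow> y \<in> T \<Longrightarrow> (1 - c) * x \<le> c * y" for k c S T
      unfolding X_set[OF that(2)] X_set[OF that(3)]
    proof (rule lower[OF that(1)])
      fix x y assume "x \<in> {x. x / B (\<tau> k) \<in> S}" "y \<in> {x. x / B (\<tau> k) \<in> T}"
      then have "(1 - c) * (x / B (\<tau> k)) \<le> c * (y / B (\<tau> k))" by (intro ST) auto
      then show "(1 - c) * x \<le> c * y" using Bpos[of "\<tau> k"] by (simp add: divide_le_cancel)
    qed measurable
    have upperX: "cdf (Z (r k)) c \<le> 1 - measure (X k) S * measure (X k) T"
      if "0 \<le> c" and [measurable]: "S \<in> sets borel" "T \<in> sets borel"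
        and ST: "\<And>x y. x \<in> S \<Longrightarrow> y \<in> T \<Longrightarrow> \<not> (1 - c) * x \<le> c * y" for k c S T
      unfolding X_set[OF that(2)] X_set[OF that(3)]
    proof (rule upper[OF that(1)])
      fix x y assume "x \<in> {x. x / B (\<tau> k) \<in> S}" "y \<in> {x. x / B (\<tau> k) \<in> T}"
      then have "\<not> (1 - c) * (x / B (\<tau> k)) \<le> c * (y / B (\<tau> k))" by (intro ST) auto
      then show "\<not> (1 - c) * x \<le> c * y" using Bpos[of "\<tau> k"] by (simp add: divide_le_cancel)
    qed measurable
    have medX: "eventually (\<lambda>k. 1 / 2 \<le> measure (X k) {..1} \<and> 1 / 2 \<le> measure (X k) {1..}) sequentially"
      using m_pos
    proof eventually_elim
      case (elim k)
      then have "{x. x / B (\<tau> k) \<in> {..1}} = {..m (\<tau> k)}" "{x. x / B (\<tau> k) \<in> {1..}} = {m (\<tau> k)..}"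
        by (auto simp: B_def pos_divide_le_eq pos_le_divide_eq)
      then show ?case using m[OF \<tau>, of k] by (simp add: X_set)
    qed
    have "tight X"
    proof (rule tight_if_eventually_tight[OF Xd])
      fix \<epsilon> :: real assume \<epsilon>: "0 < \<epsilon>"
      have "(cdf \<mu> \<longlongrightarrow> cdf \<mu> 0) (at_right 0)"
        using isC[of 0] unfolding isCont_def by (rule tendsto_within_subset) simp
      then have "eventually (\<lambda>c. cdf \<mu> c < \<epsilon> / 2) (at_right 0)"
        by (rule order_tendstoD(2)) (use cdf0 \<epsilon> in simp)
      then have "eventually (\<lambda>c. cdf \<mu> c < \<epsilon> / 2 \<and> c \<in> {0<..<1}) (at_right 0)"
        by (rule eventually_conj) (rule eventually_at_right_real, simp)
      then obtain c where c: "cdf \<mu> c < \<epsilon> / 2" "0 < c" "c < 1"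
        using eventually_happens[of _ "at_right (0::real)"] by auto
      define K where "K = (1 - c) / c"
      have K: "0 < K" unfolding K_def using c by simp
      have "eventually (\<lambda>k. cdf (Z (r k)) c < \<epsilon> / 2) sequentially"
        by (rule order_tendstoD(2)[OF lim c(1)])
      then have "eventually (\<lambda>k. measure (X k) {x. \<bar>x\<bar> > K} < \<epsilon>) sequentially"
        using medX
      proof eventually_elim
        case (elim k)
        interpret D: real_distribution "X k" by (rule Xd)
        have "measure (X k) {..1} * measure (X k) {K<..} \<le> cdf (Z (r k)) c"
        proof (rule lowerX)
          fix x y :: real assume "x \<in> {..1}" "y \<in> {K<..}"
          then have "(1 - c) * x \<le> (1 - c) * 1" using c by (intro mult_left_mono) auto
          also have "\<dots> = c * K" unfolding K_def using c by simp
          also have "\<dots> \<le> c * y" using \<open>y \<in> {K<..}\<close> c by (intro mult_left_mono) auto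
          finally show "(1 - c) * x \<le> c * y" .
        qed (use c in auto)
        moreover have "1 / 2 * measure (X k) {K<..} \<le> measure (X k) {..1} * measure (X k) {K<..}"
          using elim by (intro mult_right_mono) auto
        moreover have "measure (X k) {x. \<bar>x\<bar> > K} \<le> measure (X k) ({K<..} \<union> {..<0})"
          using K by (intro D.finite_measure_mono) auto
        moreover have "\<dots> \<le> measure (X k) {K<..} + measure (X k) {..<0}"
          by (intro measure_Un_le) auto
        ultimately show ?case using elim neg_X[of k] by linarith
      qed
      then show "\<exists>K. eventually (\<lambda>k. measure (X k) {x. \<bar>x\<bar> > K} < \<epsilon>) sequentially" ..
    qed
    then obtain q W where q: "strict_mono (q :: nat \<Rightarrow> nat)" and W: "real_distribution W"
      and "weak_conv_m (X \<circ> id \<circ> q) W"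
      using tight_imp_convergent_subsubsequence[of X id] by (auto simp: strict_mono_def)
    then have convW: "weak_conv_m (\<lambda>k. X (q k)) W" by (simp add: comp_def)
    interpret W: real_distribution W by fact
    have "nondegenerate W"
    proof (rule ccontr)
      assume "\<not> nondegenerate W"
      then obtain w where w: "measure W {w} = 1" unfolding nondegenerate_def by blast
      have near: "(\<lambda>k. measure (X (q k)) {w - \<eta><..<w + \<eta>}) \<longlonglongrightarrow> 1" if \<eta>: "\<eta> > 0" for \<eta>
      proof -
        have "measure W {w - \<eta><..<w + \<eta>} = 1"
          using W.finite_measure_mono[of "{w}" "{w - \<eta><..<w + \<eta>}"] w \<eta> W.prob_le_1[of "{w - \<eta><..<w + \<eta>}"]
          by auto
        moreover have "W (frontier {w - \<eta><..<w + \<eta>}) = 0"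
        proof -
          have "measure W (- {w}) = 0" using W.prob_compl[of "{w}"] w by (simp add: Compl_eq_Diff_UNIV)
          moreover have "measure W (frontier {w - \<eta><..<w + \<eta>}) \<le> measure W (- {w})"
            using \<eta> by (intro W.finite_measure_mono) (auto simp: frontier_def closure_greaterThanLessThan interior_open)
          ultimately show ?thesis by (simp add: W.emeasure_eq_measure measure_le_0_iff)
        qed
        ultimately show ?thesis
          using weak_conv_imp_continuity_set_conv[OF Xd W convW, of "{w - \<eta><..<w + \<eta>}"] by simp
      qed
      \<comment> \<open>the mass at or above the median keeps the limit point away from 0\<close>
      have medq: "eventually (\<lambda>k. 1 / 2 \<le> measure (X (q k)) {1..}) sequentially"
        using eventually_subseq[OF q medX] by (auto elim: eventually_mono)
      have w1: "1 \<le> w"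
      proof (rule ccontr)
        assume "\<not> 1 \<le> w"
        then have "eventually (\<lambda>k. 1 / 2 < measure (X (q k)) {w - (1 - w)<..<w + (1 - w)}) sequentially"
          by (intro order_tendstoD(1)[OF near]) auto
        then have "eventually (\<lambda>k. False) sequentially"
          using medq
        proof eventually_elim
          case (elim k)
          interpret D: real_distribution "X (q k)" by (rule Xd)
          let ?I = "{w - (1 - w)<..<w + (1 - w)}"
          have "measure (X (q k)) (?I \<union> {1..}) = measure (X (q k)) ?I + measure (X (q k)) {1..}"
            by (intro D.finite_measure_Union) auto
          then show False using elim D.prob_le_1[of "?I \<union> {1..}"] by linarith
        qed
        then show False by simp
      qed
      have sq: "(\<lambda>k. measure (X (q k)) {w - \<eta><..<w + \<eta>} * measure (X (q k)) {w - \<eta><..<w + \<eta>}) \<longlonglongrightarrow> 1"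
        if "\<eta> > 0" for \<eta>
        using tendsto_mult[OF near[OF that] near[OF that]] by simp
      have limq: "(\<lambda>k. cdf (Z (r (q k))) c) \<longlonglongrightarrow> cdf \<mu> c" for c
        using LIMSEQ_subseq_LIMSEQ[OF lim q] by (simp add: comp_def)
      \<comment> \<open>\<open>(1 - c) x \<le> c y\<close> holds throughout a small square around \<open>(w, w)\<close> if \<open>c > 1/2\<close>, and nowhere on it
        if \<open>c < 1/2\<close>\<close>
      have cdf_hi: "1 \<le> cdf \<mu> c" if c: "1 / 2 < c" "c < 1" for c
      proof -
        define \<eta> where "\<eta> = w * (2 * c - 1)"
        have \<eta>: "0 < \<eta>" unfolding \<eta>_def using w1 c by simp
        have "measure (X (q k)) {w - \<eta><..<w + \<eta>} * measure (X (q k)) {w - \<eta><..<w + \<eta>} \<le> cdf (Z (r (q k))) c" for k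
        proof (rule lowerX)
          fix x y assume x: "x \<in> {w - \<eta><..<w + \<eta>}" and y: "y \<in> {w - \<eta><..<w + \<eta>}"
          have "(1 - c) * x \<le> (1 - c) * (w + \<eta>)" using x c by (intro mult_left_mono) auto
          also have "\<dots> = c * (w - \<eta>)" unfolding \<eta>_def by (simp add: algebra_simps)
          also have "\<dots> \<le> c * y" using y c by (intro mult_left_mono) auto
          finally show "(1 - c) * x \<le> c * y" .
        qed (use c in auto)
        then show ?thesis by (intro LIMSEQ_le[OF sq[OF \<eta>] limq]) auto
      qed
      have cdf_lo: "cdf \<mu> c \<le> 0" if c: "0 < c" "c < 1 / 2" for c
      proof -
        define \<eta> where "\<eta> = w * (1 - 2 * c)"
        have \<eta>: "0 < \<eta>" unfolding \<eta>_def using w1 c by simp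
        have "cdf (Z (r (q k))) c \<le> 1 - measure (X (q k)) {w - \<eta><..<w + \<eta>} * measure (X (q k)) {w - \<eta><..<w + \<eta>}" for k
        proof (rule upperX)
          fix x y assume x: "x \<in> {w - \<eta><..<w + \<eta>}" and y: "y \<in> {w - \<eta><..<w + \<eta>}"
          have "c * y < c * (w + \<eta>)" using y c by (intro mult_strict_left_mono) auto
          also have "\<dots> = (1 - c) * (w - \<eta>)" unfolding \<eta>_def by (simp add: algebra_simps)
          also have "\<dots> \<le> (1 - c) * x" using x c by (intro mult_left_mono) auto
          finally show "\<not> (1 - c) * x \<le> c * y" by simp
        qed (use c in auto)
        moreover have "(\<lambda>k. 1 - measure (X (q k)) {w - \<eta><..<w + \<eta>} * measure (X (q k)) {w - \<eta><..<w + \<eta>}) \<longlonglongrightarrow> 1 - 1"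
          by (intro tendsto_diff tendsto_const sq \<eta>)
        ultimately show ?thesis using LIMSEQ_le[OF limq] by fastforce
      qed
      have "(cdf \<mu> \<longlongrightarrow> cdf \<mu> (1 / 2)) (at_right (1 / 2))" "(cdf \<mu> \<longlongrightarrow> cdf \<mu> (1 / 2)) (at_left (1 / 2))"
        using isC[of "1 / 2"] unfolding isCont_def by (auto intro: tendsto_within_subset)
      moreover have "eventually (\<lambda>c. 1 \<le> cdf \<mu> c) (at_right (1 / 2))"
        by (rule eventually_mono[OF eventually_at_right_real[of "1 / 2" 1]]) (auto intro: cdf_hi)
      moreover have "eventually (\<lambda>c. cdf \<mu> c \<le> 0) (at_left (1 / 2))"
        by (rule eventually_mono[OF eventually_at_left_real[of 0 "1 / 2"]]) (auto intro: cdf_lo)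
      ultimately have "1 \<le> cdf \<mu> (1 / 2)" "cdf \<mu> (1 / 2) \<le> 0"
        by (auto intro: tendsto_lowerbound tendsto_upperbound)
      then show False by simp
    qed
    moreover have "strict_mono (\<lambda>k. r (q k))" using r q by (simp add: strict_mono_def)
    ultimately show "\<exists>r \<mu>. strict_mono r \<and> real_distribution \<mu> \<and> nondegenerate \<mu> \<and>
        weak_conv_m (\<lambda>k. rescale (B (t (r k))) (\<nu> (t (r k)))) \<mu>"
      using W convW unfolding X_def \<tau>_def by blast
  qed
  then show ?thesis by blast
qed

section \<open>Characterization of the centered Feller class\<close>

theorem theorem2:
  fixes \<Lambda> :: "real measure"
    and M :: "real measure \<Rightarrow> 'a measure"
    and U V :: "real measure \<Rightarrow> real \<Rightarrow> 'a \<Rightarrow> real"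
    and F\<^sub>0 :: "real measure"
  assumes \<Lambda>: "subordinator_levy_measure \<Lambda>"
    and UV: "\<And>F. finite_mean_distribution F \<Longrightarrow> randomly_weighted_pair \<Lambda> F (M F) (U F) (V F)"
    and F\<^sub>0: "finite_mean_distribution F\<^sub>0"
  shows "((levy_tail \<Lambda> \<longlongrightarrow> \<infinity>) (at_right 0) \<longrightarrow>
           ((\<forall>F\<in>class_X. \<forall>\<mu>. subsequential_ratio_limit (at_right 0) (M F) (U F) (V F) \<mu>
                \<longrightarrow> continuous_distribution \<mu>)
            \<longleftrightarrow> centered_feller_class (at_right 0) (M F\<^sub>0) (V F\<^sub>0)))
       \<and> ((\<forall>F\<in>class_X. \<forall>\<mu>. subsequential_ratio_limit at_top (M F) (U F) (V F) \<mu>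
                \<longrightarrow> continuous_distribution \<mu>)
            \<longleftrightarrow> centered_feller_class at_top (M F\<^sub>0) (V F\<^sub>0))"
proof -
  have F: "finite_mean_distribution F" if "F \<in> class_X" for F using that by (simp add: class_X_def)
  have law: "real_distribution (distr (M F) borel (V F t))"
    "char (distr (M F) borel (V F t)) \<theta> = exp (complex_of_real t * levy_exponent \<Lambda> \<theta>)"
    if "finite_mean_distribution F" "t > 0" for F t \<theta>
  proof -
    interpret F: real_distribution F using that by (simp add: finite_mean_distribution_def)
    note meas = randomly_weighted_pair_measurable[OF \<Lambda> UV[OF that(1)] less_imp_le[OF that(2)]]
    show "real_distribution (distr (M F) borel (V F t))"
      by (rule prob_space.real_distribution_distr[OF meas(1,3)])
    show "char (distr (M F) borel (V F t)) \<theta> = exp (complex_of_real t * levy_exponent \<Lambda> \<theta>)"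
      using char_linear_combination[OF \<Lambda> UV[OF that(1)] that(1), of t 0 1 \<theta>] that(2) F.prob_space by simp
  qed
  let ?\<nu> = "\<lambda>t. distr (M F\<^sub>0) borel (V F\<^sub>0 t)"
  have same: "distr (M F) borel (V F t) = ?\<nu> t" if "finite_mean_distribution F" "t > 0" for F t
    by (rule Levy_uniqueness[OF law(1)[OF that] law(1)[OF F\<^sub>0 that(2)]])
       (simp add: fun_eq_iff law(2)[OF that] law(2)[OF F\<^sub>0 that(2)])
  have feller: "norms_to_feller G (M F\<^sub>0) (V F\<^sub>0) (\<lambda>_. 0) B \<longleftrightarrow> compact_norming G (\<lambda>t. distr (M F) borel (V F t)) B"
    if "finite_mean_distribution F" for F G B
  proof -
    have "distr (M F\<^sub>0) borel (\<lambda>\<omega>. (V F\<^sub>0 t \<omega> - 0) / B t) = rescale (B t) (distr (M F) borel (V F t))"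
      if "t > 0" for t
      unfolding same[OF \<open>finite_mean_distribution F\<close> \<open>t > 0\<close>]
      using randomly_weighted_pair_measurable(3)[OF \<Lambda> UV[OF F\<^sub>0] less_imp_le[OF \<open>t > 0\<close>]]
      by (simp add: rescale_distr)
    then have "(\<lambda>k. distr (M F\<^sub>0) borel (\<lambda>\<omega>. (V F\<^sub>0 (t (r k)) \<omega> - 0) / B (t (r k))))
        = (\<lambda>k. rescale (B (t (r k))) (distr (M F) borel (V F (t (r k)))))"
      if "time_sequence G t" for t and r :: "nat \<Rightarrow> nat"
      using that by (simp add: time_sequence_def)
    then show ?thesis
      unfolding norms_to_feller_def compact_norming_def by (intro conj_cong refl iff_allI imp_cong) (simp only:)
  qed
  have "(\<forall>F\<in>class_X. \<forall>\<mu>. subsequential_ratio_limit G (M F) (U F) (V F) \<mu> \<longrightarrow> continuous_distribution \<mu>)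
      \<longleftrightarrow> centered_feller_class G (M F\<^sub>0) (V F\<^sub>0)" (is "?L \<longleftrightarrow> ?R")
    if G: "G = at_right 0 \<or> G = at_top" for G
  proof
    assume ?L
    then have "\<exists>B. compact_norming G ?\<nu> B"
      using fair_coin_in_class_X
      by (intro compact_norming_if_ratio_limits_continuous[OF G \<Lambda> UV[OF F[OF fair_coin_in_class_X]] _ law[OF F\<^sub>0]]) auto
    then show ?R using feller[OF F\<^sub>0] unfolding centered_feller_class_def by blast
  next
    assume ?R
    then obtain B where B: "norms_to_feller G (M F\<^sub>0) (V F\<^sub>0) (\<lambda>_. 0) B" unfolding centered_feller_class_def by blast
    show ?L
    proof (intro ballI allI impI)
      fix F' \<mu> assume F': "F' \<in> class_X" and lim: "subsequential_ratio_limit G (M F') (U F') (V F') \<mu>"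
      have "compact_norming G (\<lambda>t. distr (M F') borel (V F' t)) B" using B feller[OF F[OF F']] by blast
      then show "continuous_distribution \<mu>"
        by (rule ratio_limit_continuous_if_compact_norming[OF G \<Lambda> UV[OF F[OF F']] F' _ lim])
    qed
  qed
  then show ?thesis by blast
qed

end
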